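(* Let $a:[0,\infty)\to(0,\infty)$ be a log-concave function (i.e. $\log a$ is concave), of class $C^2$ on $(0,\infty)$, with $\lim_{t\to\infty}\frac{\log a(t)}{t}=-\infty$, and put $a_n=a(n)$ for $n=0,1,2,\ldots$. Let $f(z)=\sum_{n\ge 0}\phi_n a_n z^n$, where the $\phi_n$ are independent standard complex Gaussian random variables. Then there is a (deterministic) set $E\subset[1,\infty)$ of finite logarithmic measure such that, as $r\to\infty$ with $r\notin E$, $$p_H(r)=S(r)+o\left(S(r)\right).$$
   Context: A standard complex Gaussian variable has density $\frac1\pi e^{-|w|^2}$ on $\mathbb{C}$. Under the stated assumptions the series $f$ almost surely has infinite radius of convergence. For $r\geq 1$: - $P_H(r)$ is the probability that $f$ has no zeros in the disk $\{|z|\le r\}$, and $p_H(r)=-\log P_H(r)$. - $\mathcal{N}_1(r)=\{n\ge 0:\ \log(a_nr^n)\ge 0\}$ (a finite set of integers), and $S(r)=2\sum_{n\in\mathcal{N}_1(r)}\log(a_nr^n)$. A measurable set $E\subset[1,\infty)$ has finite logarithmic measure if $\int_E\frac{dt}{t}<\infty$. *)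

theory Defs
  imports "HOL-Probability.Probability" "HOL-Library.Landau_Symbols"
begin

definition C2_on :: "real set \<Rightarrow> (real \<Rightarrow> real) \<Rightarrow> bool" where
  "C2_on U g \<longleftrightarrow>
    (\<exists>g' g''. (\<forall>t\<in>U. (g has_real_derivative g' t) (at t)) \<and>
              (\<forall>t\<in>U. (g' has_real_derivative g'' t) (at t)) \<and>
              continuous_on U g'')"

definition std_complex_gaussian :: "'a measure \<Rightarrow> ('a \<Rightarrow> complex) \<Rightarrow> bool" where
  "std_complex_gaussian M X \<longleftrightarrow>
    distributed M lborel X (\<lambda>w. ennreal (exp (- (cmod w)\<^sup>2) / pi))"

definition random_series :: "(nat \<Rightarrow> 'a \<Rightarrow> complex) \<Rightarrow> (nat \<Rightarrow> real) \<Rightarrow> 'a \<Rightarrow> complex \<Rightarrow> complex" where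
  "random_series \<phi> c \<omega> z = (\<Sum>n. \<phi> n \<omega> * complex_of_real (c n) * z ^ n)"

(* The series is entire only almost surely. Restricting to outcomes with infinite radius of
   convergence removes a null set; it keeps the event independent of the value of a divergent
   infinite sum. *)
definition hole_event ::
  "'a measure \<Rightarrow> (nat \<Rightarrow> 'a \<Rightarrow> complex) \<Rightarrow> (nat \<Rightarrow> real) \<Rightarrow> real \<Rightarrow> 'a set" where
  "hole_event M \<phi> c r =
    {\<omega> \<in> space M. conv_radius (\<lambda>n. \<phi> n \<omega> * complex_of_real (c n)) = \<infinity> \<and>
                  (\<forall>z. cmod z \<le> r \<longrightarrow> random_series \<phi> c \<omega> z \<noteq> 0)}"

definition hole_prob ::
  "'a measure \<Rightarrow> (nat \<Rightarrow> 'a \<Rightarrow> complex) \<Rightarrow> (nat \<Rightarrow> real) \<Rightarrow> real \<Rightarrow> real" where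
  "hole_prob M \<phi> c r = measure M (hole_event M \<phi> c r)"

(* Since ln 0 = 0, a vanishing hole probability yields the value 0 here, not infinity; this is
   incompatible with being asymptotic to a positive function. *)
definition hole_exponent ::
  "'a measure \<Rightarrow> (nat \<Rightarrow> 'a \<Rightarrow> complex) \<Rightarrow> (nat \<Rightarrow> real) \<Rightarrow> real \<Rightarrow> real" where
  "hole_exponent M \<phi> c r = - ln (hole_prob M \<phi> c r)"

definition N1 :: "(nat \<Rightarrow> real) \<Rightarrow> real \<Rightarrow> nat set" where
  "N1 c r = {n. ln (c n * r ^ n) \<ge> 0}"

definition S :: "(nat \<Rightarrow> real) \<Rightarrow> real \<Rightarrow> real" where
  "S c r = 2 * (\<Sum>n\<in>N1 c r. ln (c n * r ^ n))"

definition finite_log_measure :: "real set \<Rightarrow> bool" where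
  "finite_log_measure E \<longleftrightarrow>
    E \<in> sets lebesgue \<and> E \<subseteq> {1..} \<and> (\<integral>\<^sup>+t\<in>E. ennreal (1 / t) \<partial>lebesgue) < \<infinity>"

end

(* If f = exp g has no zeros in the disk of radius r, the Borel-Caratheodory inequality bounds the
   k-th Taylor coefficient of g by L / r^k, where L is of order S(r) outside an event of negligible
   probability. Comparing coefficients in f' = f g' gives
     a_k phi_k = f(0) g_k + (a function of phi_0, ..., phi_(k-1)),
   so, given its predecessors, phi_k lies in a disk of radius |f(0)| L / (a_k r^k). By Fubini the hole
   probability is at most the product of the squared radii over 1 <= k <= N = max N_1(r), which is
   exp(- S(r) + O(N log S(r))). Conversely, f has no zeros if phi_0 is large, |phi_k| a_k r^k is at
   most of order 1/N for 1 <= k <= 2N+1, and the remaining phi_k are at most (a_k r^k)^(-1/2); this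
   has probability exp(- S(r) - O(N log N)). Since dS / d(log r) is comparable to N^2, Borel's growth
   lemma yields N + 1 <= S^(3/5) outside a set of finite logarithmic measure, so that both errors
   are o(S). *)

theory Submission
  imports Defs "HOL-Complex_Analysis.Complex_Analysis" "HOL-Real_Asymp.Real_Asymp"
begin

section \<open>The standard complex Gaussian measure\<close>

text \<open>For the upper bound, the discarded events may cost only exp(-S) up to a factor
  exp(o(S)). So |phi_0| is confined between exp(-S) and S, and |phi_k| below exp(S) * max(1, (a_k
  r^k)^(-1/2)). Such generous limits multiply the bound on |f| by powers of exp(S), but this changes
  log |f|, hence L, only by a multiple of S; and L enters each disk radius just once, which costs
  O(log S) per coefficient. The centres of the disks are complicated functions of the predecessors,
  but the Gaussian mass of a disk is bounded by its squared radius wherever the centre lies, so only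
  their measurability matters. The power -1/2 splits a small term a_k r^k evenly between the tail
  bound 1/t_k and the contribution t_k a_k r^k to the series: both become (a_k r^k)^(1/2), which
  decays geometrically beyond N. Any exponent strictly between 1/2 and 1 could replace 3/5: above
  1/2, the lengths in Borel's lemma are summable; below 1, N log S is o(S), and N + 1 further steps
  shrink the square roots by exp(-S / (4 (N + 1))), which tends to 0. The final error exponent 7/10
  is any number between 3/5 and 1.\<close>

definition complex_gaussian :: "complex measure" where
  "complex_gaussian = density lborel (\<lambda>w. ennreal (exp (- (cmod w)\<^sup>2) / pi))"

lemma space_complex_gaussian [simp]: "space complex_gaussian = UNIV"
  by (simp add: complex_gaussian_def)

lemma sets_complex_gaussian [simp, measurable_cong]: "sets complex_gaussian = sets borel"
  by (simp add: complex_gaussian_def)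

lemma std_complex_gaussian_measurable:
  "std_complex_gaussian M X \<Longrightarrow> X \<in> borel_measurable M"
  unfolding std_complex_gaussian_def distributed_def by simp

lemma std_complex_gaussian_distr:
  "std_complex_gaussian M X \<Longrightarrow> distr M borel X = complex_gaussian"
proof -
  assume *: "std_complex_gaussian M X"
  have "distr M borel X = distr M lborel X"
    by (rule distr_cong) auto
  with * show ?thesis
    unfolding std_complex_gaussian_def distributed_def complex_gaussian_def by simp
qed

lemma emeasure_lborel_cball_complex:
  fixes c :: complex
  assumes "t \<ge> 0"
  shows "emeasure lborel (cball c t) = ennreal (pi * t\<^sup>2)"
  using emeasure_cball[OF assms, of c] by (simp add: unit_ball_vol_2)

text \<open>The density never exceeds 1/pi and the disk has area pi t^2. Uniformity in the centre
  \<open>c\<close> is what later allows centres that depend on other coefficients.\<close>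

lemma complex_gaussian_cball_le:
  assumes "t \<ge> 0"
  shows "emeasure complex_gaussian (cball c t) \<le> ennreal (t\<^sup>2)"
proof -
  have "emeasure complex_gaussian (cball c t) =
      (\<integral>\<^sup>+w. ennreal (exp (- (cmod w)\<^sup>2) / pi) * indicator (cball c t) w \<partial>lborel)"
    unfolding complex_gaussian_def by (rule emeasure_density) auto
  also have "\<dots> \<le> (\<integral>\<^sup>+w. ennreal (1 / pi) * indicator (cball c t) w \<partial>lborel)"
    by (intro nn_integral_mono mult_right_mono ennreal_leI divide_right_mono) auto
  also have "\<dots> = ennreal (1 / pi) * ennreal (pi * t\<^sup>2)"
    using assms by (subst nn_integral_cmult_indicator) (auto simp: emeasure_lborel_cball_complex)
  also have "\<dots> = ennreal (t\<^sup>2)"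
    by (simp add: ennreal_mult[symmetric])
  finally show ?thesis .
qed

text \<open>No point of the disk is farther from 0 than \<open>cmod c + t\<close>, so the density
  there is at least its value at that distance.\<close>

lemma complex_gaussian_cball_ge:
  assumes "t \<ge> 0"
  shows "emeasure complex_gaussian (cball c t) \<ge> ennreal (exp (- (cmod c + t)\<^sup>2) * t\<^sup>2)"
proof -
  have "ennreal (exp (- (cmod c + t)\<^sup>2) * t\<^sup>2) =
      ennreal (exp (- (cmod c + t)\<^sup>2) / pi) * ennreal (pi * t\<^sup>2)"
    by (simp add: ennreal_mult[symmetric])
  also have "\<dots> = (\<integral>\<^sup>+w. ennreal (exp (- (cmod c + t)\<^sup>2) / pi) * indicator (cball c t) w \<partial>lborel)"
    using assms by (subst nn_integral_cmult_indicator) (auto simp: emeasure_lborel_cball_complex)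
  also have "\<dots> \<le> (\<integral>\<^sup>+w. ennreal (exp (- (cmod w)\<^sup>2) / pi) * indicator (cball c t) w \<partial>lborel)"
  proof (intro nn_integral_mono)
    fix w :: complex
    have "cmod w \<le> cmod c + t" if "w \<in> cball c t"
      using that norm_triangle_ineq2[of w c] by (auto simp: dist_norm norm_minus_commute)
    then show "ennreal (exp (- (cmod c + t)\<^sup>2) / pi) * indicator (cball c t) w
        \<le> ennreal (exp (- (cmod w)\<^sup>2) / pi) * indicator (cball c t) w"
      by (auto simp: indicator_def intro!: ennreal_leI divide_right_mono power_mono)
  qed
  also have "\<dots> = emeasure complex_gaussian (cball c t)"
    unfolding complex_gaussian_def by (rule emeasure_density[symmetric]) auto
  finally show ?thesis .
qed

text \<open>The substitution w = sqrt 2 * x turns exp(-|w|^2 / 2) into exp(-|x|^2); the value 2 is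
  the Jacobian in real dimension two. The total mass 1 comes from the hypothesis instead of an
  explicit integration.\<close>

lemma complex_gaussian_exp_moment:
  assumes "prob_space complex_gaussian"
  shows "(\<integral>\<^sup>+w. ennreal (exp ((cmod w)\<^sup>2 / 2)) \<partial>complex_gaussian) = 2"
proof -
  have 1: "(\<integral>\<^sup>+w. ennreal (exp (- (cmod w)\<^sup>2) / pi) \<partial>lborel) = 1"
    using prob_space.emeasure_space_1[OF assms]
    by (simp add: complex_gaussian_def emeasure_density)
  have "(\<integral>\<^sup>+w. ennreal (exp ((cmod w)\<^sup>2 / 2)) \<partial>complex_gaussian) =
      (\<integral>\<^sup>+w. ennreal (exp (- (cmod w)\<^sup>2) / pi) * ennreal (exp ((cmod w)\<^sup>2 / 2)) \<partial>lborel)"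
    unfolding complex_gaussian_def by (rule nn_integral_density) auto
  also have "\<dots> = (\<integral>\<^sup>+w. ennreal (exp (- (cmod w)\<^sup>2 / 2) / pi) \<partial>lborel)"
    by (intro nn_integral_cong) (simp add: ennreal_mult[symmetric] exp_add[symmetric])
  also have "\<dots> = (\<integral>\<^sup>+w. ennreal (exp (- (cmod w)\<^sup>2 / 2) / pi)
      \<partial>density (distr lborel borel (\<lambda>x. 0 + sqrt 2 *\<^sub>R x)) (\<lambda>_. \<bar>sqrt 2\<bar> ^ DIM(complex)))"
    by (subst lborel_affine[of "sqrt 2" "0::complex"]) auto
  also have "\<dots> = (\<integral>\<^sup>+w. 2 * ennreal (exp (- (cmod w)\<^sup>2) / pi) \<partial>lborel)"
    by (simp add: nn_integral_density nn_integral_distr power_mult_distrib)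
  also have "\<dots> = 2"
    by (simp add: nn_integral_cmult 1)
  finally show ?thesis .
qed

text \<open>Markov's inequality for exp(|w|^2 / 2). The exact tail is exp(-t^2), but half the
  exponent is enough.\<close>

lemma complex_gaussian_tail:
  assumes "prob_space complex_gaussian" "t \<ge> 0"
  shows "emeasure complex_gaussian {w. cmod w > t} \<le> ennreal (2 * exp (- t\<^sup>2 / 2))"
proof -
  let ?u = "\<lambda>w. ennreal (exp ((cmod w)\<^sup>2 / 2))"
  have "emeasure complex_gaussian {w. cmod w > t} \<le>
      emeasure complex_gaussian {w \<in> UNIV. 1 \<le> ennreal (exp (- t\<^sup>2 / 2)) * ?u w}"
    using assms(2)
    by (intro emeasure_mono)
      (auto simp: ennreal_mult[symmetric] exp_add[symmetric] power_mono simp flip: ennreal_1)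
  also have "\<dots> \<le> ennreal (exp (- t\<^sup>2 / 2)) * (\<integral>\<^sup>+w. ?u w * indicator UNIV w \<partial>complex_gaussian)"
    by (rule nn_integral_Markov_inequality) auto
  also have "\<dots> = ennreal (2 * exp (- t\<^sup>2 / 2))"
    using complex_gaussian_exp_moment[OF assms(1)]
    by (simp add: ennreal_mult mult.commute)
  finally show ?thesis .
qed

text \<open>A crude form for families of thresholds: the reciprocals 2 / t are easy to sum, and
  thresholds of size exp(S) still make them negligible.\<close>

lemma complex_gaussian_tail':
  assumes "prob_space complex_gaussian" "t > 0"
  shows "emeasure complex_gaussian {w. cmod w > t} \<le> ennreal (2 / t)"
proof -
  have "t \<le> 1 + t\<^sup>2 / 2"
    using zero_le_power2[of "t - 1"] by (simp add: power2_diff)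
  also have "\<dots> \<le> exp (t\<^sup>2 / 2)" by (rule exp_ge_add_one_self)
  finally have "2 * exp (- t\<^sup>2 / 2) \<le> 2 / t"
    using assms(2) by (simp add: exp_minus field_simps)
  with complex_gaussian_tail[OF assms(1), of t] assms(2) show ?thesis
    by (meson ennreal_leI less_imp_le order_trans)
qed

section \<open>Taylor coefficients of the logarithm of a power series\<close>

text \<open>Cauchy's formula for the k-th derivative, read as a Fourier coefficient of
  \<open>h\<close> on the circle of radius \<open>s\<close>.\<close>

lemma has_integral_circle_coeff:
  fixes h :: "complex \<Rightarrow> complex"
  assumes "h holomorphic_on ball 0 r" "0 < s" "s < r"
  shows "((\<lambda>x. h (of_real s * cis (2 * pi * x)) * cis (- (2 * pi * real k * x))) has_integral
           of_real (s ^ k) * (deriv ^^ k) h 0 / fact k) {0..1}"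
proof -
  have "((\<lambda>u. h u / (u - 0) ^ Suc k) has_contour_integral
      (2 * pi * \<i> / fact k * (deriv ^^ k) h 0)) (circlepath 0 s)"
    by (rule Cauchy_has_contour_integral_higher_derivative_circlepath)
      (use assms in \<open>auto intro!: holomorphic_on_imp_continuous_on holomorphic_on_subset[OF assms(1)]\<close>)
  then have "((\<lambda>x. h (circlepath 0 s x) / (circlepath 0 s x - 0) ^ Suc k *
      vector_derivative (circlepath 0 s) (at x within {0..1})) has_integral
      2 * pi * \<i> / fact k * (deriv ^^ k) h 0) {0..1}"
    by (simp add: has_contour_integral_def)
  from has_integral_mult_right[OF this, of "of_real (s ^ k) / (2 * pi * \<i>)"]
  have "((\<lambda>x. of_real (s ^ k) / (2 * pi * \<i>) * (h (circlepath 0 s x) / (circlepath 0 s x - 0) ^ Suc k *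
      vector_derivative (circlepath 0 s) (at x within {0..1}))) has_integral
      of_real (s ^ k) * (deriv ^^ k) h 0 / fact k) {0..1}"
    by (simp add: field_simps)
  then show ?thesis
  proof (rule has_integral_eq[rotated])
    fix x :: real assume "x \<in> {0..1}"
    have e: "exp (2 * of_real pi * \<i> * of_real x) = cis (2 * pi * x)"
      by (simp add: cis_conv_exp mult_ac)
    have c: "circlepath 0 s x = of_real s * cis (2 * pi * x)"
      by (simp add: circlepath e)
    have v: "vector_derivative (circlepath 0 s) (at x within {0..1}) =
        2 * pi * \<i> * of_real s * cis (2 * pi * x)"
      using \<open>x \<in> {0..1}\<close> by (simp add: vector_derivative_circlepath01 e)
    have i: "cis (- (2 * pi * real k * x)) = inverse (cis (2 * pi * x) ^ k)"
      by (simp add: Complex.DeMoivre mult.left_commute mult.commute)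
    show "of_real (s ^ k) / (2 * pi * \<i>) * (h (circlepath 0 s x) / (circlepath 0 s x - 0) ^ Suc k *
      vector_derivative (circlepath 0 s) (at x within {0..1})) =
      h (of_real s * cis (2 * pi * x)) * cis (- (2 * pi * real k * x))"
      unfolding i c v using assms(2) by (simp add: power_mult_distrib field_simps)
  qed
qed

text \<open>Fourier coefficients of negative index vanish: by the mean value property, since h(z)
  z^k is holomorphic and is 0 at 0.\<close>

lemma has_integral_circle_zero:
  fixes h :: "complex \<Rightarrow> complex"
  assumes "h holomorphic_on ball 0 r" "0 < s" "s < r" "k > 0"
  shows "((\<lambda>x. h (of_real s * cis (2 * pi * x)) * cis (2 * pi * real k * x)) has_integral 0) {0..1}"
proof -
  have "(\<lambda>z. h z * z ^ k) holomorphic_on ball 0 r"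
    by (intro holomorphic_intros assms)
  from has_integral_circle_coeff[OF this assms(2,3), of 0]
  have "((\<lambda>x. h (of_real s * cis (2 * pi * x)) * (of_real s * cis (2 * pi * x)) ^ k) has_integral 0) {0..1}"
    using assms(4) by (simp add: power_0_left)
  from has_integral_mult_right[OF this, of "of_real (1 / s ^ k)"] show ?thesis
    using assms(2) by (simp add: power_mult_distrib Complex.DeMoivre mult_ac)
qed

text \<open>Adding the conjugate of the vanishing integral of index -k replaces \<open>h\<close> by
  h + cnj h = 2 Re h without changing the Fourier coefficient. Since Re h has one sign, the integral
  of its modulus is again a mean value.\<close>

lemma Borel_Caratheodory_coeff_aux:
  fixes h :: "complex \<Rightarrow> complex"
  assumes hol: "h holomorphic_on ball 0 r" and s: "0 < s" "s < r" and k: "k > 0"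
    and le: "\<And>z. z \<in> ball 0 r \<Longrightarrow> Re (h z) \<le> 0"
  shows "cmod ((deriv ^^ k) h 0 / fact k) * s ^ k \<le> - 2 * Re (h 0)"
proof -
  define u where "u x = of_real s * cis (2 * pi * x)" for x
  define e where "e x = cis (- (2 * pi * real k * x))" for x
  have "((\<lambda>x. cnj (h (u x) * cis (2 * pi * real k * x))) has_integral cnj 0) {0..1}"
    using has_integral_circle_zero[OF hol s k] unfolding u_def
    by (subst has_integral_cnj[unfolded comp_def])
  then have "((\<lambda>x. cnj (h (u x)) * e x) has_integral 0) {0..1}"
    by (simp add: cis_cnj e_def)
  from has_integral_add[OF has_integral_circle_coeff[OF hol s, of k, folded u_def e_def] this]
  have 1: "((\<lambda>x. (h (u x) + cnj (h (u x))) * e x) has_integral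
      of_real (s ^ k) * (deriv ^^ k) h 0 / fact k) {0..1}"
    by (simp add: algebra_simps)
  have "((\<lambda>x. h (u x)) has_integral h 0) {0..1}"
    using has_integral_circle_coeff[OF hol s, of 0] by (simp add: u_def)
  from has_integral_mult_right[OF has_integral_Re[OF this], of "-2"]
  have 2: "((\<lambda>x. - 2 * Re (h (u x))) has_integral - 2 * Re (h 0)) {0..1}" by simp
  have "norm (integral {0..1} (\<lambda>x. (h (u x) + cnj (h (u x))) * e x)) \<le>
      integral {0..1} (\<lambda>x. - 2 * Re (h (u x)))"
  proof (rule integral_norm_bound_integral)
    show "(\<lambda>x. (h (u x) + cnj (h (u x))) * e x) integrable_on {0..1}"
      "(\<lambda>x. - 2 * Re (h (u x))) integrable_on {0..1}"
      using 1 2 by (auto simp: integrable_on_def)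
    fix x :: real
    have "Re (h (u x)) \<le> 0"
      using s by (intro le) (auto simp: u_def norm_mult)
    then show "norm ((h (u x) + cnj (h (u x))) * e x) \<le> - 2 * Re (h (u x))"
      by (simp add: complex_add_cnj norm_mult e_def)
  qed
  then show ?thesis
    using s unfolding integral_unique[OF 1] integral_unique[OF 2]
    by (simp add: norm_mult norm_divide norm_power mult_ac)
qed

text \<open>Apply the previous lemma to h - A. As \<open>h\<close> is only given on the open disk,
  the circles have radius s < r and s tends to r at the end.\<close>

lemma Borel_Caratheodory_coeff:
  fixes h :: "complex \<Rightarrow> complex"
  assumes hol: "h holomorphic_on ball 0 r" and r: "0 < r" and k: "k > 0"
    and le: "\<And>z. z \<in> ball 0 r \<Longrightarrow> Re (h z) \<le> A"
  shows "cmod ((deriv ^^ k) h 0 / fact k) * r ^ k \<le> 2 * (A - Re (h 0))"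
proof -
  have d: "(deriv ^^ k) (\<lambda>z. h z - of_real A) 0 = (deriv ^^ k) h 0"
    using k r by (subst higher_deriv_diff[OF hol, of "\<lambda>_. of_real A"]) (auto intro!: holomorphic_intros)
  have "cmod ((deriv ^^ k) h 0 / fact k) * s ^ k \<le> 2 * (A - Re (h 0))" if s: "0 < s" "s < r" for s
  proof -
    have "(\<lambda>z. h z - of_real A) holomorphic_on ball 0 r"
      by (intro holomorphic_intros hol)
    from Borel_Caratheodory_coeff_aux[OF this s k] le show ?thesis
      by (simp add: d)
  qed
  then have "eventually (\<lambda>s. cmod ((deriv ^^ k) h 0 / fact k) * s ^ k \<le> 2 * (A - Re (h 0))) (at_left r)"
    using r eventually_at_left_real[of 0 r] by (auto elim!: eventually_mono)
  moreover have "((\<lambda>s. cmod ((deriv ^^ k) h 0 / fact k) * s ^ k) \<longlongrightarrow>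
      cmod ((deriv ^^ k) h 0 / fact k) * r ^ k) (at_left r)"
    by (intro tendsto_intros)
  ultimately show ?thesis
    by (intro tendsto_upperbound) auto
qed

text \<open>Taylor coefficients of a logarithm of \<open>\<Sum>n. y n * z ^ n\<close>, read off from
  the identity \<open>f' = f * g'\<close> for \<open>f = exp g\<close>.\<close>

fun log_coeff :: "(nat \<Rightarrow> complex) \<Rightarrow> nat \<Rightarrow> complex" where
  "log_coeff y k = (y k - (\<Sum>i\<in>{1..<k}. of_nat (k - i) / of_nat k * y i * log_coeff y (k - i))) / y 0"

declare log_coeff.simps [simp del]

text \<open>Compare the coefficients of z^(k-1): k y_k is the sum of (k - i) y_i G_(k-i) over i < k,
  and the term i = 0 isolates G_k.\<close>

lemma log_coeff_eq:
  fixes y :: "nat \<Rightarrow> complex" and G :: "complex fps"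
  assumes "fps_deriv (Abs_fps y) = Abs_fps y * fps_deriv G" "y 0 \<noteq> 0" "k > 0"
  shows "fps_nth G k = log_coeff y k"
  using \<open>k > 0\<close>
proof (induction k rule: less_induct)
  case (less k)
  then obtain m where m: "k = Suc m" by (cases k) auto
  have "of_nat k * y k = (\<Sum>i=0..m. y i * (of_nat (k - i) * fps_nth G (k - i)))"
  proof -
    have "of_nat k * y k = fps_nth (fps_deriv (Abs_fps y)) m"
      by (simp add: m)
    also have "\<dots> = (\<Sum>i=0..m. y i * (of_nat (Suc (m - i)) * fps_nth G (Suc (m - i))))"
      by (simp add: assms(1) fps_mult_nth)
    also have "\<dots> = (\<Sum>i=0..m. y i * (of_nat (k - i) * fps_nth G (k - i)))"
      by (intro sum.cong) (auto simp: m Suc_diff_le simp del: of_nat_Suc)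
    finally show ?thesis .
  qed
  also have "{0..m} = insert 0 {1..<k}" by (auto simp: m)
  also have "(\<Sum>i\<in>insert 0 {1..<k}. y i * (of_nat (k - i) * fps_nth G (k - i))) =
      y 0 * (of_nat k * fps_nth G k) + (\<Sum>i\<in>{1..<k}. y i * (of_nat (k - i) * fps_nth G (k - i)))"
    by (subst sum.insert) auto
  also have "(\<Sum>i\<in>{1..<k}. y i * (of_nat (k - i) * fps_nth G (k - i))) =
      of_nat k * (\<Sum>i\<in>{1..<k}. of_nat (k - i) / of_nat k * y i * log_coeff y (k - i))"
    unfolding sum_distrib_left using less by (intro sum.cong) (auto simp: field_simps)
  finally have "of_nat k * y k = of_nat k * (y 0 * fps_nth G k +
      (\<Sum>i\<in>{1..<k}. of_nat (k - i) / of_nat k * y i * log_coeff y (k - i)))"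
    by (simp add: algebra_simps)
  then have "y k = y 0 * fps_nth G k +
      (\<Sum>i\<in>{1..<k}. of_nat (k - i) / of_nat k * y i * log_coeff y (k - i))"
    using less.prems by simp
  then have "y k - (\<Sum>i\<in>{1..<k}. of_nat (k - i) / of_nat k * y i * log_coeff y (k - i)) = y 0 * fps_nth G k"
    by (simp only: add_diff_cancel_right')
  then show ?case
    using assms(2) by (subst log_coeff.simps) simp
qed

text \<open>On a disk without zeros the series is exp g with Re g = ln |f| \<le> ln B, so the
  coefficient form of Borel-Caratheodory applies to g; the recursion identifies its coefficients
  with \<open>log_coeff y\<close>.\<close>

lemma log_coeff_bound:
  fixes y :: "nat \<Rightarrow> complex"
  assumes conv: "conv_radius y > r" and r: "r > 0"
    and nz: "\<And>z. cmod z < r \<Longrightarrow> (\<Sum>n. y n * z ^ n) \<noteq> 0"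
    and le: "\<And>z. cmod z < r \<Longrightarrow> cmod (\<Sum>n. y n * z ^ n) \<le> B"
    and k: "k > 0"
  shows "cmod (log_coeff y k) * r ^ k \<le> 2 * (ln B - ln (cmod (y 0)))"
proof -
  define F where "F = Abs_fps y"
  have cF: "fps_conv_radius F > r"
    using conv by (simp add: F_def fps_conv_radius_def)
  have ev: "eval_fps F z = (\<Sum>n. y n * z ^ n)" for z
    by (simp add: F_def eval_fps_def)
  have "ball 0 r \<subseteq> eball 0 (fps_conv_radius F)"
    using cF 
    by (auto simp: eball_def intro!: less_trans[OF _ cF])
  then have hol: "eval_fps F holomorphic_on ball 0 r"
    by (intro holomorphic_on_eval_fps)
  obtain g where g: "g holomorphic_on ball 0 r" "\<And>x. x \<in> ball 0 r \<Longrightarrow> exp (g x) = eval_fps F x"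
    using holomorphic_logarithm_exists[of "ball 0 r" "eval_fps F" 0] hol nz r
    by (auto simp: ev)
  obtain G where G: "g has_fps_expansion G"
    using analytic_at_imp_has_fps_expansion_0[of g] g(1) r
    by (metis analytic_at centre_in_ball open_ball)
  have Fx: "eval_fps F has_fps_expansion F"
    using cF r by (intro eval_fps_has_fps_expansion) (auto intro: less_trans[of 0 "ereal r"])
  have dev: "eventually (\<lambda>z. z \<in> ball 0 r) (nhds (0::complex))"
    using r by (intro eventually_nhds_in_open) auto
  have "eventually (\<lambda>z. deriv (eval_fps F) z = eval_fps F z * deriv g z) (nhds 0)"
    using dev
  proof eventually_elim
    case (elim z)
    have "(g has_field_derivative deriv g z) (at z)"
      using g(1) elim by (simp add: holomorphic_derivI)
    then have "((\<lambda>z. exp (g z)) has_field_derivative exp (g z) * deriv g z) (at z)"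
      by (rule DERIV_fun_exp)
    then have "(eval_fps F has_field_derivative exp (g z) * deriv g z) (at z)"
      by (rule DERIV_cong_ev[THEN iffD1, rotated -1])
        (use elim g(2) in \<open>auto simp: eventually_nhds intro!: exI[of _ "ball 0 r"]\<close>)
    then show ?case using g(2) elim by (simp add: DERIV_imp_deriv)
  qed
  moreover have "deriv (eval_fps F) has_fps_expansion fps_deriv F"
    by (intro has_fps_expansion_deriv Fx)
  ultimately have "(\<lambda>z. eval_fps F z * deriv g z) has_fps_expansion fps_deriv F"
    by (rule has_fps_expansion_cong[OF _ refl, THEN iffD1])
  moreover have "(\<lambda>z. eval_fps F z * deriv g z) has_fps_expansion F * fps_deriv G"
    by (intro has_fps_expansion_mult Fx has_fps_expansion_deriv G)
  ultimately have "fps_deriv F = F * fps_deriv G"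
    by (rule fps_expansion_unique_complex)
  moreover have y0: "y 0 \<noteq> 0"
    using nz[of 0] r by simp
  ultimately have eq: "log_coeff y k = (deriv ^^ k) g 0 / fact k"
    using log_coeff_eq[of y G k] k fps_nth_fps_expansion[OF G] by (simp add: F_def)
  have Re_g: "Re (g z) = ln (cmod (eval_fps F z))" if "z \<in> ball 0 r" for z
    using g(2)[OF that, symmetric] by simp
  have "Re (g z) \<le> ln B" if "z \<in> ball 0 r" for z
  proof -
    have "0 < cmod (eval_fps F z)" "cmod (eval_fps F z) \<le> B"
      using nz[of z] le[of z] that by (auto simp: ev)
    then show ?thesis unfolding Re_g[OF that] by (intro ln_mono)
  qed
  from Borel_Caratheodory_coeff[OF g(1) r k this] have
    "cmod (log_coeff y k) * r ^ k \<le> 2 * (ln B - Re (g 0))"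
    by (simp add: eq)
  then show ?thesis
    using r by (simp add: Re_g eval_fps_at_0 F_def)
qed

section \<open>Independent Gaussian coefficients\<close>

text \<open>For measurability: the limsup is a measurable function of the coefficients.\<close>

lemma conv_radius_eq_PInf_iff:
  "conv_radius f = \<infinity> \<longleftrightarrow> limsup (\<lambda>n. ereal (root n (norm (f n)))) = 0"
proof -
  have "inverse x = \<infinity> \<longleftrightarrow> x = 0" for x :: ereal
    by (cases x) (auto simp: ereal_inverse_eq_0)
  then show ?thesis by (simp add: conv_radius_def)
qed

lemma continuous_on_power_series_entire:
  fixes y :: "nat \<Rightarrow> complex"
  assumes "conv_radius y = \<infinity>"
  shows "continuous_on UNIV (\<lambda>z. \<Sum>n. y n * z ^ n)"
proof -
  have "fps_conv_radius (Abs_fps y) = \<infinity>"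
    using assms by (simp add: fps_conv_radius_def)
  then have "continuous_on UNIV (eval_fps (Abs_fps y))"
    by (intro continuous_on_eval_fps[THEN continuous_on_subset]) auto
  then show ?thesis by (simp add: eval_fps_def[abs_def])
qed

text \<open>Locality of the recursion: it permits evaluation on a restricted sequence and makes the
  disk centres functions of the predecessors alone.\<close>

lemma log_coeff_cong:
  "(\<And>i. i \<le> k \<Longrightarrow> y i = y' i) \<Longrightarrow> log_coeff y k = log_coeff y' k"
proof (induction k rule: less_induct)
  case (less k)
  have "(\<Sum>i\<in>{1..<k}. of_nat (k - i) / of_nat k * y i * log_coeff y (k - i)) =
      (\<Sum>i\<in>{1..<k}. of_nat (k - i) / of_nat k * y' i * log_coeff y' (k - i))"
    using less.prems by (intro sum.cong refl arg_cong2[of _ _ _ _ times] less.IH) auto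
  then show ?case
    using less.prems by (subst (1 2) log_coeff.simps) simp
qed

lemma measurable_log_coeff:
  fixes Y :: "'a \<Rightarrow> nat \<Rightarrow> complex"
  assumes "\<And>i. i \<le> k \<Longrightarrow> (\<lambda>x. Y x i) \<in> borel_measurable M"
  shows "(\<lambda>x. log_coeff (Y x) k) \<in> borel_measurable M"
  using assms
proof (induction k rule: less_induct)
  case (less k)
  show ?case
    by (subst log_coeff.simps)
      (intro borel_measurable_divide borel_measurable_diff borel_measurable_sum
        borel_measurable_times borel_measurable_const less; simp)
qed

locale gaussian_seq = prob_space M for M :: "'a measure" +
  fixes \<phi> :: "nat \<Rightarrow> 'a \<Rightarrow> complex"
  assumes indep: "indep_vars (\<lambda>_. borel) \<phi> UNIV"
    and gauss: "\<And>n. std_complex_gaussian M (\<phi> n)"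
begin

lemma measurable_gaussian [measurable]: "\<phi> n \<in> borel_measurable M"
  using gauss by (rule std_complex_gaussian_measurable)

text \<open>The normalisation is inherited from the law of \<open>\<phi> 0\<close>, so the Gaussian
  integral need not be computed.\<close>

lemma prob_space_complex_gaussian: "prob_space complex_gaussian"
  using prob_space_distr[of "\<phi> 0" borel] std_complex_gaussian_distr[OF gauss, of 0] by simp

lemma emeasure_gaussian:
  assumes "A \<in> sets borel"
  shows "emeasure M (\<phi> n -` A \<inter> space M) = emeasure complex_gaussian A"
  using emeasure_distr[of "\<phi> n" M borel A] assms std_complex_gaussian_distr[OF gauss, of n] by simp

lemma emeasure_tail:
  assumes "t > 0"
  shows "emeasure M {\<omega> \<in> space M. cmod (\<phi> n \<omega>) > t} \<le> ennreal (2 / t)"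
proof -
  have "{\<omega> \<in> space M. cmod (\<phi> n \<omega>) > t} = \<phi> n -` {w. cmod w > t} \<inter> space M" by auto
  then show ?thesis
    using emeasure_gaussian[of "{w. cmod w > t}" n]
      complex_gaussian_tail'[OF prob_space_complex_gaussian assms] by simp
qed

lemma emeasure_tail_exp:
  assumes "t > 0"
  shows "emeasure M {\<omega> \<in> space M. cmod (\<phi> n \<omega>) > t} \<le> ennreal (2 * exp (- t\<^sup>2 / 2))"
proof -
  have "{\<omega> \<in> space M. cmod (\<phi> n \<omega>) > t} = \<phi> n -` {w. cmod w > t} \<inter> space M" by auto
  then show ?thesis
    using emeasure_gaussian[of "{w. cmod w > t}" n]
      complex_gaussian_tail[OF prob_space_complex_gaussian, of t] assms by simp
qed

lemma emeasure_small:
  assumes "t > 0"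
  shows "emeasure M {\<omega> \<in> space M. cmod (\<phi> n \<omega>) \<le> t} \<le> ennreal (t\<^sup>2)"
proof -
  have "{\<omega> \<in> space M. cmod (\<phi> n \<omega>) \<le> t} = \<phi> n -` cball 0 t \<inter> space M" by auto
  then show ?thesis
    using emeasure_gaussian[of "cball 0 t" n] complex_gaussian_cball_le[of t 0] assms by simp
qed

text \<open>The uncountable condition is made countable: absence of zeros on a compact disk means a
  lower bound 1 / (m + 1) for |f|, attained minimum by compactness, and by continuity such a bound
  need only be tested on a countable dense set.\<close>

lemma hole_event_measurable:
  "hole_event M \<phi> c r \<in> sets M"
proof -
  obtain D where D: "countable D" "D \<subseteq> cball (0::complex) r" "cball 0 r \<subseteq> closure D"
    by (rule separable)
  define f where "f = random_series \<phi> c"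
  have [measurable]: "(\<lambda>\<omega>. f \<omega> z) \<in> borel_measurable M" for z
    unfolding f_def random_series_def by measurable
  have "hole_event M \<phi> c r = {\<omega> \<in> space M.
      limsup (\<lambda>n. ereal (root n (norm (\<phi> n \<omega> * complex_of_real (c n))))) = 0 \<and>
      (\<exists>m::nat. \<forall>z\<in>D. 1 / real (Suc m) \<le> cmod (f \<omega> z))}"
  proof -
    have "(\<forall>z. cmod z \<le> r \<longrightarrow> f \<omega> z \<noteq> 0) \<longleftrightarrow>
        (\<exists>m::nat. \<forall>z\<in>D. 1 / real (Suc m) \<le> cmod (f \<omega> z))"
      if "conv_radius (\<lambda>n. \<phi> n \<omega> * complex_of_real (c n)) = \<infinity>" for \<omega>
    proof -
      have cont: "continuous_on UNIV (f \<omega>)"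
        unfolding f_def random_series_def using continuous_on_power_series_entire[OF that] .
      show ?thesis
      proof (cases "r \<ge> 0")
        \<comment> \<open>For negative \<open>r\<close> the disk, and with it \<open>D\<close>, is
          empty, so both sides hold vacuously.\<close>
        case False
        then show ?thesis using D(2) by (auto dest: order_trans[OF norm_ge_zero])
      next
        case True
        show ?thesis
        proof
          assume nz: "\<forall>z. cmod z \<le> r \<longrightarrow> f \<omega> z \<noteq> 0"
          have "\<exists>x\<in>cball 0 r. \<forall>y\<in>cball 0 r. cmod (f \<omega> x) \<le> cmod (f \<omega> y)"
            using True by (intro continuous_attains_inf compact_cball continuous_on_norm
                continuous_on_subset[OF cont]) auto
          then obtain x where x: "cmod x \<le> r" "\<And>y. cmod y \<le> r \<Longrightarrow> cmod (f \<omega> x) \<le> cmod (f \<omega> y)"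
            by auto
          then have "cmod (f \<omega> x) > 0" using nz by simp
          then obtain m where "inverse (real (Suc m)) < cmod (f \<omega> x)"
            using reals_Archimedean by blast
          then have "\<forall>z\<in>D. 1 / real (Suc m) \<le> cmod (f \<omega> z)"
            using x D(2) by (force simp: inverse_eq_divide)
          then show "\<exists>m::nat. \<forall>z\<in>D. 1 / real (Suc m) \<le> cmod (f \<omega> z)" ..
        next
          assume "\<exists>m::nat. \<forall>z\<in>D. 1 / real (Suc m) \<le> cmod (f \<omega> z)"
          then obtain m :: nat where m: "\<And>z. z \<in> D \<Longrightarrow> 1 / real (Suc m) \<le> cmod (f \<omega> z)" by blast
          have "closed {z. 1 / real (Suc m) \<le> cmod (f \<omega> z)}"
            by (intro closed_Collect_le continuous_on_norm cont continuous_on_const)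
          with m have "closure D \<subseteq> {z. 1 / real (Suc m) \<le> cmod (f \<omega> z)}"
            by (intro closure_minimal) auto
          then have "1 / real (Suc m) \<le> cmod (f \<omega> z)" if "cmod z \<le> r" for z
            using that D(3) by auto
          moreover have "1 / real (Suc m) > 0" by simp
          ultimately show "\<forall>z. cmod z \<le> r \<longrightarrow> f \<omega> z \<noteq> 0"
            by (metis norm_zero not_le)
        qed
      qed
    qed
    then show ?thesis
      unfolding hole_event_def f_def[symmetric] conv_radius_eq_PInf_iff[symmetric] by blast
  qed
  also have "\<dots> \<in> sets M"
  proof (intro sets.sets_Collect_conj sets.sets_Collect_countable_Ex sets.sets_Collect_countable_All' D(1))
    have [measurable]: "(\<lambda>\<omega>. limsup (\<lambda>n. ereal (root n (norm (\<phi> n \<omega> * complex_of_real (c n))))))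
        \<in> borel_measurable M"
      by measurable
    show "{\<omega> \<in> space M. limsup (\<lambda>n. ereal (root n (norm (\<phi> n \<omega> * complex_of_real (c n))))) = 0} \<in> sets M"
      by measurable
    show "{\<omega> \<in> space M. 1 / real (Suc m) \<le> cmod (f \<omega> z)} \<in> sets M" for m z
      by measurable
  qed
  finally show ?thesis .
qed

section \<open>Upper bound for the hole probability by iterated disks\<close>

text \<open>Induction on \<open>n\<close>, integrating out the last coordinate by Fubini: for fixed
  predecessors its section lies in a disk of radius \<open>\<rho> (Suc n)\<close>, of mass at most
  the squared radius wherever the centre is. Coordinate 0 is unconstrained and contributes a factor
  at most 1.\<close>

lemma emeasure_iterated_discs_PiM:
  fixes F :: "nat \<Rightarrow> (nat \<Rightarrow> complex) \<Rightarrow> complex" and \<rho> :: "nat \<Rightarrow> real" and n :: nat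
  assumes F: "\<And>k. F k \<in> borel_measurable (PiM {..<k} (\<lambda>_. borel))"
    and \<rho>: "\<And>k. \<rho> k \<ge> 0"
  shows "{x \<in> space (PiM {..n} (\<lambda>_. complex_gaussian)).
       \<forall>k\<in>{1..n}. cmod (x k - F k (restrict x {..<k})) \<le> \<rho> k} \<in> sets (PiM {..n} (\<lambda>_. borel))"
    and "emeasure (PiM {..n} (\<lambda>_. complex_gaussian)) {x \<in> space (PiM {..n} (\<lambda>_. complex_gaussian)).
       \<forall>k\<in>{1..n}. cmod (x k - F k (restrict x {..<k})) \<le> \<rho> k} \<le> (\<Prod>k\<in>{1..n}. ennreal ((\<rho> k)\<^sup>2))"
proof -
  interpret cg: prob_space complex_gaussian by (rule prob_space_complex_gaussian)
  interpret product_prob_space "\<lambda>_. complex_gaussian" by standard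
  let ?P = "\<lambda>n. PiM {..n} (\<lambda>_::nat. complex_gaussian)"
  define A where "A n = {x \<in> space (?P n). \<forall>k\<in>{1..n}. cmod (x k - F k (restrict x {..<k})) \<le> \<rho> k}" for n
  have sets_P: "sets (PiM I (\<lambda>_::nat. complex_gaussian)) = sets (PiM I (\<lambda>_. borel))" for I
    by (intro sets_PiM_cong) auto
  have meas: "A n \<in> sets (?P n)" for n
    unfolding A_def
  proof (intro sets.sets_Collect_finite_All)
    fix k assume k: "k \<in> {1..n}"
    have "(\<lambda>x. restrict x {..<k}) \<in> measurable (?P n) (PiM {..<k} (\<lambda>_. complex_gaussian))"
      using k by (intro measurable_restrict_subset) auto
    then have [measurable]: "(\<lambda>x. F k (restrict x {..<k})) \<in> borel_measurable (?P n)"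
      using F[of k] by (intro measurable_compose[OF _ F]) (simp add: measurable_cong_sets[OF refl sets_P])
    have [measurable]: "(\<lambda>x. x k) \<in> borel_measurable (?P n)"
      using measurable_component_singleton[of k "{..n}" "\<lambda>_. complex_gaussian"] k
      by (simp add: measurable_cong_sets[OF refl sets_complex_gaussian])
    show "{x \<in> space (?P n). cmod (x k - F k (restrict x {..<k})) \<le> \<rho> k} \<in> sets (?P n)"
      by measurable
  qed auto
  then show "A n \<in> sets (PiM {..n} (\<lambda>_. borel))" by (simp add: sets_P)
  show "emeasure (?P n) (A n) \<le> (\<Prod>k\<in>{1..n}. ennreal ((\<rho> k)\<^sup>2))"
  proof (induction n)
    case 0
    show ?case
      using prob_space.measure_le_1[OF prob_space_PiM[OF prob_space_complex_gaussian]] by simp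
  next
    case (Suc n)
    have "emeasure (?P (Suc n)) (A (Suc n)) =
        (\<integral>\<^sup>+x. indicator (A (Suc n)) x \<partial>PiM (insert (Suc n) {..n}) (\<lambda>_. complex_gaussian))"
      using meas[of "Suc n"] by (simp add: atMost_Suc)
    also have "\<dots> = (\<integral>\<^sup>+x. \<integral>\<^sup>+y. indicator (A (Suc n)) (x(Suc n := y)) \<partial>complex_gaussian \<partial>?P n)"
      using meas[of "Suc n"] by (intro product_nn_integral_insert) (auto simp: atMost_Suc)
    also have "\<dots> \<le> (\<integral>\<^sup>+x. ennreal ((\<rho> (Suc n))\<^sup>2) * indicator (A n) x \<partial>?P n)"
    proof (intro nn_integral_mono)
      fix x assume x: "x \<in> space (?P n)"
      let ?B = "cball (F (Suc n) (restrict x {..<Suc n})) (\<rho> (Suc n))"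
      have "(\<integral>\<^sup>+y. indicator (A (Suc n)) (x(Suc n := y)) \<partial>complex_gaussian) \<le>
          (\<integral>\<^sup>+y. indicator (A n) x * indicator ?B y \<partial>complex_gaussian)"
      proof (intro nn_integral_mono)
        fix y :: complex
        have "x \<in> A n \<and> y \<in> ?B" if "x(Suc n := y) \<in> A (Suc n)"
        proof -
          have *: "cmod ((x(Suc n := y)) k - F k (restrict (x(Suc n := y)) {..<k})) \<le> \<rho> k"
            if "k \<in> {1..Suc n}" for k
            using \<open>x(Suc n := y) \<in> A (Suc n)\<close> that by (auto simp: A_def)
          have r: "restrict (x(Suc n := y)) {..<k} = restrict x {..<k}" if "k \<le> Suc n" for k
            using that by (auto simp: restrict_def)
          have "cmod (x k - F k (restrict x {..<k})) \<le> \<rho> k" if "k \<in> {1..n}" for k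
            using *[of k] r[of k] that by auto
          moreover have "cmod (y - F (Suc n) (restrict x {..<Suc n})) \<le> \<rho> (Suc n)"
            using *[of "Suc n"] r[of "Suc n"] by auto
          ultimately show ?thesis
            using x by (auto simp: A_def dist_norm norm_minus_commute)
        qed
        then show "indicator (A (Suc n)) (x(Suc n := y)) \<le> (indicator (A n) x * indicator ?B y :: ennreal)"
          by (auto simp: indicator_def)
      qed
      also have "\<dots> = indicator (A n) x * emeasure complex_gaussian ?B"
        by (subst nn_integral_cmult) (auto intro!: borel_measurable_indicator)
      also have "\<dots> \<le> indicator (A n) x * ennreal ((\<rho> (Suc n))\<^sup>2)"
        using \<rho> by (intro mult_left_mono complex_gaussian_cball_le) auto
      finally show "(\<integral>\<^sup>+y. indicator (A (Suc n)) (x(Suc n := y)) \<partial>complex_gaussian) \<le>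
          ennreal ((\<rho> (Suc n))\<^sup>2) * indicator (A n) x"
        by (simp add: mult.commute)
    qed
    also have "\<dots> = ennreal ((\<rho> (Suc n))\<^sup>2) * emeasure (?P n) (A n)"
      using meas by (rule nn_integral_cmult_indicator)
    also have "\<dots> \<le> ennreal ((\<rho> (Suc n))\<^sup>2) * (\<Prod>k\<in>{1..n}. ennreal ((\<rho> k)\<^sup>2))"
      by (intro mult_left_mono Suc.IH) auto
    also have "\<dots> = (\<Prod>k\<in>{1..Suc n}. ennreal ((\<rho> k)\<^sup>2))"
      by (simp add: atLeastAtMostSuc_conv mult.commute)
    finally show ?case .
  qed
qed

text \<open>Independence makes the joint law of \<open>\<phi> 0\<close>, ...,
  \<open>\<phi> n\<close> the product measure, which transfers the previous bound to
  \<open>M\<close>.\<close>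

lemma emeasure_iterated_discs:
  fixes F :: "nat \<Rightarrow> (nat \<Rightarrow> complex) \<Rightarrow> complex" and \<rho> :: "nat \<Rightarrow> real" and n :: nat
  assumes F: "\<And>k. F k \<in> borel_measurable (PiM {..<k} (\<lambda>_. borel))"
    and \<rho>: "\<And>k. \<rho> k \<ge> 0"
  defines "A \<equiv> {\<omega> \<in> space M. \<forall>k\<in>{1..n}. cmod (\<phi> k \<omega> - F k (\<lambda>i\<in>{..<k}. \<phi> i \<omega>)) \<le> \<rho> k}"
  shows "A \<in> sets M" and "emeasure M A \<le> (\<Prod>k\<in>{1..n}. ennreal ((\<rho> k)\<^sup>2))"
proof -
  let ?X = "\<lambda>\<omega>. \<lambda>i\<in>{..n}. \<phi> i \<omega>"
  let ?P = "PiM {..n} (\<lambda>_. complex_gaussian)"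
  let ?B = "{x \<in> space ?P. \<forall>k\<in>{1..n}. cmod (x k - F k (restrict x {..<k})) \<le> \<rho> k}"
  have B: "?B \<in> sets (PiM {..n} (\<lambda>_. borel))"
    by (rule emeasure_iterated_discs_PiM(1)[OF F \<rho>])
  have X: "?X \<in> measurable M (PiM {..n} (\<lambda>_. borel))"
    by (intro measurable_restrict measurable_gaussian)
  have eq: "A = ?X -` ?B \<inter> space M"
  proof -
    have "restrict (?X \<omega>) {..<k} = (\<lambda>i\<in>{..<k}. \<phi> i \<omega>)" if "k \<in> {1..n}" for k \<omega>
      using that by (auto simp: restrict_def)
    then show ?thesis
      by (auto simp: A_def space_PiM)
  qed
  show "A \<in> sets M" unfolding eq by (rule measurable_sets[OF X B])
  have "indep_vars (\<lambda>_. borel) \<phi> {..n}"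
    using indep by (rule indep_vars_subset) auto
  then have "distr M (PiM {..n} (\<lambda>_. borel)) ?X = PiM {..n} (\<lambda>i. distr M borel (\<phi> i))"
    by (subst (asm) indep_vars_iff_distr_eq_PiM) auto
  then have "distr M (PiM {..n} (\<lambda>_. borel)) ?X = ?P"
    by (simp add: std_complex_gaussian_distr[OF gauss])
  with emeasure_distr[OF X B] have "emeasure M A = emeasure ?P ?B"
    unfolding eq by metis
  also have "\<dots> \<le> (\<Prod>k\<in>{1..n}. ennreal ((\<rho> k)\<^sup>2))"
    by (rule emeasure_iterated_discs_PiM(2)[OF F \<rho>])
  finally show "emeasure M A \<le> (\<Prod>k\<in>{1..n}. ennreal ((\<rho> k)\<^sup>2))" .
qed

text \<open>The four summands belong to the events \<open>A1\<close> to \<open>A4\<close>: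
  \<open>\<phi> 0\<close> too small, \<open>\<phi> 0\<close> too large, some coefficient above its
  threshold, and all of \<open>\<phi> 1\<close>, ..., \<open>\<phi> n\<close> in their disks. Off
  the first three, |f| \<le> B and |f(0)| > c_0 \<delta>, so a hole bounds every
  \<open>log_coeff\<close> by L / r^k and forces the fourth. The parameters stay free here and are
  chosen in \<open>hole_prob_le\<close>.\<close>

lemma hole_prob_upper:
  fixes c t :: "nat \<Rightarrow> real" and r \<delta> T B L :: real and n :: nat
  assumes c: "\<And>k. c k > 0" and r: "r > 0" and \<delta>: "\<delta> > 0" and T: "T > 0" and t: "\<And>k. t k > 0"
    and summ: "summable (\<lambda>k. t k * c k * r ^ k)" and B: "(\<Sum>k. t k * c k * r ^ k) \<le> B"
    and summ': "summable (\<lambda>k. 2 / t k)" and L: "2 * (ln B - ln (c 0 * \<delta>)) \<le> L" "0 \<le> L"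
  shows "hole_prob M \<phi> c r \<le> \<delta>\<^sup>2 + 2 * exp (- T\<^sup>2 / 2) + (\<Sum>k. 2 / t k) +
    (\<Prod>k\<in>{1..n}. (c 0 * T * L / (c k * r ^ k))\<^sup>2)"
proof -
  \<comment> \<open>The centre of the k-th disk: the part of the recursion for
    \<open>log_coeff\<close> at \<open>k\<close> that involves only earlier coefficients, divided by
    \<open>c k\<close>.\<close>
  define F where "F k x = (\<Sum>i\<in>{1..<k}. of_nat (k - i) / of_nat k * (x i * complex_of_real (c i)) *
    log_coeff (\<lambda>i. x i * complex_of_real (c i)) (k - i)) / complex_of_real (c k)" for k x
  define \<rho> where "\<rho> k = c 0 * T * L / (c k * r ^ k)" for k
  have F: "F k \<in> borel_measurable (PiM {..<k} (\<lambda>_. borel))" for k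
  proof -
    have 1: "(\<lambda>x. x i * complex_of_real (c i)) \<in> borel_measurable (PiM {..<k} (\<lambda>_. borel))"
      if "i < k" for i
      using measurable_component_singleton[of i "{..<k}" "\<lambda>_. borel :: complex measure"] that
      by (intro borel_measurable_times borel_measurable_const) auto
    have 2: "(\<lambda>x. log_coeff (\<lambda>i. x i * complex_of_real (c i)) j)
        \<in> borel_measurable (PiM {..<k} (\<lambda>_. borel))" if "j < k" for j
      using that by (intro measurable_log_coeff 1) auto
    show ?thesis
      unfolding F_def
      by (intro borel_measurable_divide borel_measurable_sum borel_measurable_times
          borel_measurable_const 1 2) auto
  qed
  have \<rho>: "\<rho> k \<ge> 0" for k
    using c[of 0] c[of k] r T L by (simp add: \<rho>_def)
  define A1 where "A1 = {\<omega> \<in> space M. cmod (\<phi> 0 \<omega>) \<le> \<delta>}"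
  define A2 where "A2 = {\<omega> \<in> space M. cmod (\<phi> 0 \<omega>) > T}"
  define A3 where "A3 k = {\<omega> \<in> space M. cmod (\<phi> k \<omega>) > t k}" for k
  define A4 where "A4 = {\<omega> \<in> space M. \<forall>k\<in>{1..n}. cmod (\<phi> k \<omega> - F k (\<lambda>i\<in>{..<k}. \<phi> i \<omega>)) \<le> \<rho> k}"
  have [measurable]: "A1 \<in> sets M" "A2 \<in> sets M" "A3 k \<in> sets M" for k
    unfolding A1_def A2_def A3_def by measurable
  have [measurable]: "A4 \<in> sets M"
    unfolding A4_def by (rule emeasure_iterated_discs(1)[OF F \<rho>])
  have sub: "hole_event M \<phi> c r \<subseteq> A1 \<union> A2 \<union> (\<Union>k. A3 k) \<union> A4"
  proof
    fix \<omega> assume \<omega>: "\<omega> \<in> hole_event M \<phi> c r"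
    then have sp: "\<omega> \<in> space M" by (simp add: hole_event_def)
    show "\<omega> \<in> A1 \<union> A2 \<union> (\<Union>k. A3 k) \<union> A4"
    proof (rule ccontr)
      assume neg: "\<omega> \<notin> A1 \<union> A2 \<union> (\<Union>k. A3 k) \<union> A4"
      define y where "y k = \<phi> k \<omega> * complex_of_real (c k)" for k
      have b: "\<delta> < cmod (\<phi> 0 \<omega>)" "cmod (\<phi> 0 \<omega>) \<le> T" "cmod (\<phi> k \<omega>) \<le> t k" for k
        using neg sp by (auto simp: A1_def A2_def A3_def not_le not_less)
      have y0: "y 0 \<noteq> 0" using b(1) \<delta> c[of 0] by (auto simp: y_def)
      have bound: "cmod (\<Sum>k. y k * z ^ k) \<le> B" if "cmod z < r" for z
      proof -
        have le: "norm (y k * z ^ k) \<le> t k * c k * r ^ k" for k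
          using b(3)[of k] c[of k] that less_imp_le[OF t[of k]]
          by (auto simp: y_def norm_mult norm_power intro!: mult_mono power_mono)
        have "norm (\<Sum>k. y k * z ^ k) \<le> (\<Sum>k. t k * c k * r ^ k)"
          by (rule norm_suminf_le[OF le summ])
        with B show ?thesis by simp
      qed
      have lc: "cmod (log_coeff y k) * r ^ k \<le> L" if "k > 0" for k
      proof -
        have "cmod (log_coeff y k) * r ^ k \<le> 2 * (ln B - ln (cmod (y 0)))"
        proof (rule log_coeff_bound[OF _ r _ bound that])
          show "ereal r < conv_radius y"
            using \<omega> by (simp add: hole_event_def y_def[abs_def])
          show "(\<Sum>n. y n * z ^ n) \<noteq> 0" if "cmod z < r" for z
            using \<omega> that by (auto simp: hole_event_def y_def random_series_def)
        qed
        also have "\<dots> \<le> 2 * (ln B - ln (c 0 * \<delta>))"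
        proof -
          have "ln (c 0 * \<delta>) \<le> ln (cmod (y 0))"
            using b(1) \<delta> c[of 0] by (intro ln_mono) (auto simp: y_def norm_mult mult.commute)
          then show ?thesis by simp
        qed
        finally show ?thesis using L(1) by linarith
      qed
      have "cmod (\<phi> k \<omega> - F k (\<lambda>i\<in>{..<k}. \<phi> i \<omega>)) \<le> \<rho> k" if k: "k \<in> {1..n}" for k
      proof -
        let ?s = "\<Sum>i\<in>{1..<k}. of_nat (k - i) / of_nat k * y i * log_coeff y (k - i)"
        have "log_coeff (\<lambda>i. (\<lambda>i\<in>{..<k}. \<phi> i \<omega>) i * complex_of_real (c i)) (k - i) = log_coeff y (k - i)"
          if "i \<in> {1..<k}" for i
          using that by (intro log_coeff_cong) (auto simp: y_def)
        then have F_eq: "F k (\<lambda>i\<in>{..<k}. \<phi> i \<omega>) = ?s / complex_of_real (c k)"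
          unfolding F_def by (intro arg_cong2[of _ _ _ _ "(/)"] sum.cong) (auto simp: y_def)
        have ck: "complex_of_real (c k) \<noteq> 0" using c[of k] by simp
        have "log_coeff y k * y 0 = y k - ?s"
          using y0 by (subst log_coeff.simps) simp
        then have "\<phi> k \<omega> - F k (\<lambda>i\<in>{..<k}. \<phi> i \<omega>) = log_coeff y k * y 0 / complex_of_real (c k)"
          using ck by (simp add: F_eq y_def diff_divide_distrib)
        then have "cmod (\<phi> k \<omega> - F k (\<lambda>i\<in>{..<k}. \<phi> i \<omega>)) = cmod (log_coeff y k) * cmod (y 0) / c k"
          using c[of k] by (simp add: norm_mult norm_divide)
        also have "\<dots> \<le> (L / r ^ k) * (c 0 * T) / c k"
        proof (intro divide_right_mono mult_mono)
          show "cmod (log_coeff y k) \<le> L / r ^ k"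
            using lc[of k] k r by (simp add: pos_le_divide_eq)
          show "cmod (y 0) \<le> c 0 * T"
            using b(2) c[of 0] by (simp add: y_def norm_mult mult.commute mult_left_mono)
        qed (use L r c[of k] in auto)
        also have "\<dots> = \<rho> k" by (simp add: \<rho>_def mult_ac)
        finally show ?thesis .
      qed
      then have "\<omega> \<in> A4" using sp by (simp add: A4_def)
      with neg show False by simp
    qed
  qed
  have "emeasure M (hole_event M \<phi> c r) \<le> emeasure M (A1 \<union> A2 \<union> (\<Union>k. A3 k) \<union> A4)"
    by (intro emeasure_mono sub) measurable
  also have "\<dots> \<le> emeasure M A1 + emeasure M A2 + (\<Sum>k. emeasure M (A3 k)) + emeasure M A4"
  proof -
    have "emeasure M (A1 \<union> A2 \<union> (\<Union>k. A3 k) \<union> A4) \<le> emeasure M (A1 \<union> A2 \<union> (\<Union>k. A3 k)) + emeasure M A4"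
      by (intro emeasure_subadditive) measurable
    also have "emeasure M (A1 \<union> A2 \<union> (\<Union>k. A3 k)) \<le> emeasure M (A1 \<union> A2) + emeasure M (\<Union>k. A3 k)"
      by (intro emeasure_subadditive) measurable
    also have "emeasure M (A1 \<union> A2) \<le> emeasure M A1 + emeasure M A2"
      by (intro emeasure_subadditive) measurable
    also have "emeasure M (\<Union>k. A3 k) \<le> (\<Sum>k. emeasure M (A3 k))"
      by (intro emeasure_subadditive_countably) auto
    finally show ?thesis by (simp add: add_mono)
  qed
  also have "\<dots> \<le> ennreal (\<delta>\<^sup>2) + ennreal (2 * exp (- T\<^sup>2 / 2)) + (\<Sum>k. ennreal (2 / t k)) +
      (\<Prod>k\<in>{1..n}. ennreal ((\<rho> k)\<^sup>2))"
    unfolding A1_def A2_def A3_def A4_def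
    by (intro add_mono emeasure_small emeasure_tail_exp suminf_le emeasure_tail
        emeasure_iterated_discs(2) \<delta> T t F \<rho>) auto
  also have "(\<Sum>k. ennreal (2 / t k)) = ennreal (\<Sum>k. 2 / t k)"
    using t by (intro suminf_ennreal2 summ') (simp add: less_imp_le)
  also have "(\<Prod>k\<in>{1..n}. ennreal ((\<rho> k)\<^sup>2)) = ennreal (\<Prod>k\<in>{1..n}. (\<rho> k)\<^sup>2)"
    by (intro prod_ennreal) auto
  also have "ennreal (\<delta>\<^sup>2) + ennreal (2 * exp (- T\<^sup>2 / 2)) + ennreal (\<Sum>k. 2 / t k) +
      ennreal (\<Prod>k\<in>{1..n}. (\<rho> k)\<^sup>2) =
      ennreal (\<delta>\<^sup>2 + 2 * exp (- T\<^sup>2 / 2) + (\<Sum>k. 2 / t k) + (\<Prod>k\<in>{1..n}. (\<rho> k)\<^sup>2))"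
    using t by (simp add: ennreal_plus[symmetric] suminf_nonneg[OF summ'] less_imp_le prod_nonneg
        del: ennreal_plus)
  finally have "ennreal (hole_prob M \<phi> c r) \<le>
      ennreal (\<delta>\<^sup>2 + 2 * exp (- T\<^sup>2 / 2) + (\<Sum>k. 2 / t k) + (\<Prod>k\<in>{1..n}. (\<rho> k)\<^sup>2))"
    unfolding hole_prob_def emeasure_eq_measure .
  moreover have "0 \<le> \<delta>\<^sup>2 + 2 * exp (- T\<^sup>2 / 2) + (\<Sum>k. 2 / t k) + (\<Prod>k\<in>{1..n}. (\<rho> k)\<^sup>2)"
    using t by (intro add_nonneg_nonneg suminf_nonneg[OF summ'] prod_nonneg) (auto simp: less_imp_le)
  ultimately show ?thesis
    unfolding \<rho>_def[symmetric] using ennreal_le_iff by blast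
qed

section \<open>Lower bound for the hole probability by a dominating constant term\<close>

text \<open>By \<open>big\<close>, the constant term outweighs all others on the disk, so no zero
  can occur. The infinitely many tail conditions are not multiplied but removed by a union bound
  relative to the event \<open>A\<close> on the first coefficients; \<open>half\<close> leaves at
  least half of \<open>A\<close>.\<close>

lemma hole_prob_lower:
  fixes c t \<rho> :: "nat \<Rightarrow> real" and r K :: real and m :: nat
  assumes c: "\<And>k. c k > 0" and r: "r > 0" and \<rho>: "\<And>k. 0 \<le> \<rho> k" "\<And>k. \<rho> k \<le> 1"
    and t: "\<And>k. t k > 0" and K: "K > 0"
    and conv: "conv_radius (\<lambda>k. t k * c k) = \<infinity>"
    and big: "(\<Sum>k\<in>{1..m}. \<rho> k * (c k * r ^ k)) + (\<Sum>k. t (k + Suc m) * c (k + Suc m) * r ^ (k + Suc m)) < c 0 * K"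
    and summ: "summable (\<lambda>k. 2 / t (k + Suc m))" and half: "(\<Sum>k. 2 / t (k + Suc m)) \<le> 1 / 2"
  shows "hole_prob M \<phi> c r \<ge> 1 / 2 * exp (- (K + 2)\<^sup>2) * (\<Prod>k\<in>{1..m}. exp (-1) * (\<rho> k)\<^sup>2)"
proof -
  define W where "W k = (if k = 0 then {w. cmod w \<ge> K} else cball (0::complex) (\<rho> k))" for k
  define A where "A = (\<Inter>k\<in>{..m}. \<phi> k -` W k \<inter> space M)"
  define V where "V k = {w::complex. cmod w > t (k + Suc m)}" for k
  \<comment> \<open>Intersecting with \<open>A\<close> matters: by independence the removed
    probability is proportional to that of \<open>A\<close>. A union bound without this factor would
    be useless, as \<open>A\<close> is itself very rare.\<close>
  define D where "D k = A \<inter> (\<phi> (k + Suc m) -` V k \<inter> space M)" for k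
  have W: "W k \<in> sets borel" for k
    unfolding W_def by auto
  have V: "V k \<in> sets borel" for k
    unfolding V_def by simp
  have A [measurable]: "A \<in> sets M"
    unfolding A_def using W by (intro sets.finite_INT measurable_sets[OF measurable_gaussian]) auto
  have D [measurable]: "D k \<in> sets M" for k
    unfolding D_def using V by (intro sets.Int A measurable_sets[OF measurable_gaussian])
  define g where "g k B = prob (\<phi> k -` B \<inter> space M)" for k B
  have prob_A: "prob A = (\<Prod>k\<in>{..m}. g k (W k))"
    unfolding A_def g_def using W by (intro indep_varsD[OF indep]) auto
  have prob_D: "prob (D k) = g (k + Suc m) (V k) * prob A" for k
  proof -
    define W' where "W' i = (if i = k + Suc m then V k else W i)" for i
    have "D k = (\<Inter>i\<in>insert (k + Suc m) {..m}. \<phi> i -` W' i \<inter> space M)"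
      by (auto simp: D_def A_def W'_def)
    also have "prob \<dots> = (\<Prod>i\<in>insert (k + Suc m) {..m}. g i (W' i))"
      unfolding g_def using W V by (intro indep_varsD[OF indep]) (auto simp: W'_def)
    also have "\<dots> = g (k + Suc m) (W' (k + Suc m)) * (\<Prod>i\<in>{..m}. g i (W' i))"
      by (subst prod.insert) auto
    also have "(\<Prod>i\<in>{..m}. g i (W' i)) = prob A"
      unfolding prob_A by (intro prod.cong) (auto simp: W'_def)
    finally show ?thesis by (simp add: W'_def)
  qed
  have D_le: "emeasure M (D k) \<le> ennreal (2 / t (k + Suc m) * prob A)" for k
  proof -
    have "emeasure M (\<phi> (k + Suc m) -` V k \<inter> space M) \<le> ennreal (2 / t (k + Suc m))"
      using emeasure_gaussian[OF V, of "k + Suc m" k] t[of "k + Suc m"]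
        complex_gaussian_tail'[OF prob_space_complex_gaussian, of "t (k + Suc m)"]
      by (simp add: V_def)
    then have "g (k + Suc m) (V k) \<le> 2 / t (k + Suc m)"
      using t[of "k + Suc m"] by (simp add: g_def emeasure_eq_measure)
    then show ?thesis
      unfolding emeasure_eq_measure prob_D by (intro ennreal_leI mult_right_mono) auto
  qed
  have "emeasure M (\<Union>k. D k) \<le> (\<Sum>k. emeasure M (D k))"
    using D by (intro emeasure_subadditive_countably) auto
  also have "\<dots> \<le> (\<Sum>k. ennreal (2 / t (k + Suc m) * prob A))"
    by (intro suminf_le D_le) auto
  also have "\<dots> = ennreal (\<Sum>k. 2 / t (k + Suc m) * prob A)"
    using t by (intro suminf_ennreal2 summable_mult2 summ) (simp add: less_imp_le)
  also have "\<dots> = ennreal ((\<Sum>k. 2 / t (k + Suc m)) * prob A)"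
    using suminf_mult2[OF summ, of "prob A"] by simp
  also have "\<dots> \<le> ennreal (1 / 2 * prob A)"
    by (intro ennreal_leI mult_right_mono half) auto
  finally have UD: "prob (\<Union>k. D k) \<le> 1 / 2 * prob A"
    by (simp add: emeasure_eq_measure)
  have "A - (\<Union>k. D k) \<subseteq> hole_event M \<phi> c r"
  proof
    fix \<omega> assume \<omega>: "\<omega> \<in> A - (\<Union>k. D k)"
    then have sp: "\<omega> \<in> space M" by (auto simp: A_def)
    have "\<phi> 0 \<omega> \<in> W 0" using \<omega> by (auto simp: A_def)
    then have b0: "cmod (\<phi> 0 \<omega>) \<ge> K" by (simp add: W_def)
    have b1: "cmod (\<phi> k \<omega>) \<le> \<rho> k" if "k \<in> {1..m}" for k
    proof -
      have "\<phi> k \<omega> \<in> W k" using \<omega> that by (auto simp: A_def)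
      then show ?thesis using that by (simp add: W_def)
    qed
    have b2: "cmod (\<phi> k \<omega>) \<le> t k" if "k > m" for k
    proof -
      have "\<omega> \<notin> D (k - Suc m)" using \<omega> by blast
      then show ?thesis using \<omega> sp that by (auto simp: D_def V_def)
    qed
    define y where "y k = \<phi> k \<omega> * complex_of_real (c k)" for k
    have summ_y: "summable (\<lambda>k. norm (y k * z ^ k))" for z
    proof (rule summable_comparison_test_ev)
      show "summable (\<lambda>k. norm ((t k * c k) * (cmod z) ^ k))"
        by (intro abs_summable_in_conv_radius) (simp add: conv)
      show "eventually (\<lambda>k. norm (norm (y k * z ^ k)) \<le> norm ((t k * c k) * (cmod z) ^ k)) sequentially"
        using eventually_gt_at_top[of m]
      proof eventually_elim
        case (elim k)
        have "cmod (\<phi> k \<omega>) * c k * cmod z ^ k \<le> t k * c k * cmod z ^ k"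
          using b2[OF elim] c[of k] by (intro mult_right_mono) auto
        then show ?case
          using c[of k] t[of k] by (simp add: y_def norm_mult norm_power abs_mult)
      qed
    qed
    have "conv_radius y = \<infinity>"
      using summ_y by (intro conv_radius_inftyI'') (rule summable_norm_cancel)
    moreover have "random_series \<phi> c \<omega> z \<noteq> 0" if z: "cmod z \<le> r" for z
    proof
      assume "random_series \<phi> c \<omega> z = 0"
      then have "(\<Sum>k. y k * z ^ k) = 0" by (simp add: random_series_def y_def)
      moreover have sy: "summable (\<lambda>k. y k * z ^ k)"
        using summ_y by (rule summable_norm_cancel)
      ultimately have eq: "(\<Sum>k. y (k + Suc m) * z ^ (k + Suc m)) + (\<Sum>k<Suc m. y k * z ^ k) = 0"
        by (simp only: suminf_split_initial_segment[OF sy, of "Suc m", symmetric])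
      have "{..<Suc m} = insert 0 {1..m}" by auto
      then have "(\<Sum>k<Suc m. y k * z ^ k) = y 0 + (\<Sum>k\<in>{1..m}. y k * z ^ k)"
        by simp
      with eq have "(\<Sum>k. y (k + Suc m) * z ^ (k + Suc m)) + (y 0 + (\<Sum>k\<in>{1..m}. y k * z ^ k)) = 0"
        by (simp only:)
      moreover have "b = - (s + a)" if "a + (b + s) = 0" for a b s :: complex
        using that by algebra
      ultimately have y0: "y 0 = - ((\<Sum>k\<in>{1..m}. y k * z ^ k) + (\<Sum>k. y (k + Suc m) * z ^ (k + Suc m)))"
        by blast
      have "cmod (y 0) \<le> cmod (\<Sum>k\<in>{1..m}. y k * z ^ k) + cmod (\<Sum>k. y (k + Suc m) * z ^ (k + Suc m))"
        unfolding y0 norm_minus_cancel by (rule norm_triangle_ineq)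
      also have "cmod (\<Sum>k\<in>{1..m}. y k * z ^ k) \<le> (\<Sum>k\<in>{1..m}. \<rho> k * (c k * r ^ k))"
      proof (rule sum_norm_le)
        fix k assume k: "k \<in> {1..m}"
        have "cmod (y k * z ^ k) = cmod (\<phi> k \<omega>) * (c k * cmod z ^ k)"
          using c[of k] by (simp add: y_def norm_mult norm_power)
        also have "\<dots> \<le> \<rho> k * (c k * r ^ k)"
          using b1[OF k] c[of k] z \<rho>(1)[of k] by (intro mult_mono power_mono) auto
        finally show "cmod (y k * z ^ k) \<le> \<rho> k * (c k * r ^ k)" .
      qed
      also have "cmod (\<Sum>k. y (k + Suc m) * z ^ (k + Suc m)) \<le>
          (\<Sum>k. t (k + Suc m) * c (k + Suc m) * r ^ (k + Suc m))"
      proof (rule norm_suminf_le)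
        have "summable (\<lambda>k. t k * c k * r ^ k)"
          by (intro summable_in_conv_radius) (simp add: conv)
        then show "summable (\<lambda>k. t (k + Suc m) * c (k + Suc m) * r ^ (k + Suc m))"
          by (rule summable_ignore_initial_segment)
        fix k
        let ?k = "k + Suc m"
        have "cmod (y ?k * z ^ ?k) = cmod (\<phi> ?k \<omega>) * c ?k * cmod z ^ ?k"
          using c[of ?k] by (simp add: y_def norm_mult norm_power)
        also have "\<dots> \<le> t ?k * c ?k * r ^ ?k"
          using b2[of ?k] c[of ?k] t[of ?k] z by (intro mult_mono power_mono) auto
        finally show "cmod (y ?k * z ^ ?k) \<le> t ?k * c ?k * r ^ ?k" .
      qed
      finally have "cmod (y 0) < c 0 * K" using big by linarith
      moreover have "cmod (y 0) \<ge> c 0 * K"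
        using b0 c[of 0] by (simp add: y_def norm_mult mult.commute mult_left_mono)
      ultimately show False by simp
    qed
    ultimately show "\<omega> \<in> hole_event M \<phi> c r"
      using sp by (simp add: hole_event_def y_def[abs_def])
  qed
  then have "prob (A - (\<Union>k. D k)) \<le> hole_prob M \<phi> c r"
    unfolding hole_prob_def by (intro finite_measure_mono hole_event_measurable)
  moreover have "prob (A - (\<Union>k. D k)) = prob A - prob (\<Union>k. D k)"
  proof (rule finite_measure_Diff[OF A])
    show "(\<Union>k. D k) \<in> sets M" using D by blast
    show "(\<Union>k. D k) \<subseteq> A" by (auto simp: D_def)
  qed
  ultimately have "1 / 2 * prob A \<le> hole_prob M \<phi> c r"
    using UD by simp
  moreover have "exp (- (K + 2)\<^sup>2) * (\<Prod>k\<in>{1..m}. exp (-1) * (\<rho> k)\<^sup>2) \<le> prob A"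
  proof -
    have "{..m} = insert 0 {1..m}" by auto
    then have "prob A = g 0 (W 0) * (\<Prod>k\<in>{1..m}. g k (W k))"
      unfolding prob_A by simp
    moreover have "exp (- (K + 2)\<^sup>2) \<le> g 0 (W 0)"
    proof -
      \<comment> \<open>The unit disk about K + 1 lies in the region |w| \<ge> K; its farthest point
        has modulus K + 2, the origin of the exponent.\<close>
      have "ennreal (exp (- (cmod (of_real (K + 1)) + 1)\<^sup>2) * 1\<^sup>2) \<le>
          emeasure complex_gaussian (cball (of_real (K + 1)) 1)"
        by (rule complex_gaussian_cball_ge) simp
      also have "\<dots> \<le> emeasure complex_gaussian (W 0)"
      proof (rule emeasure_mono)
        show "cball (of_real (K + 1)) 1 \<subseteq> W 0"
        proof
          fix w :: complex assume "w \<in> cball (of_real (K + 1)) 1"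
          then have "cmod (of_real (K + 1) - w) \<le> 1" by (simp add: dist_norm)
          then have "cmod (complex_of_real (K + 1)) - cmod w \<le> 1"
            using norm_triangle_ineq2[of "complex_of_real (K + 1)" w] by linarith
          then show "w \<in> W 0" using K by (simp add: W_def del: of_real_add)
        qed
      qed (use W in simp)
      also have "\<dots> = ennreal (g 0 (W 0))"
        using emeasure_gaussian[OF W, of 0 0] by (simp add: g_def emeasure_eq_measure)
      finally have "ennreal (exp (- (cmod (of_real (K + 1)) + 1)\<^sup>2) * 1\<^sup>2) \<le> ennreal (g 0 (W 0))" .
      moreover have "cmod (of_real (K + 1)) + 1 = K + 2"
        using K by (simp del: of_real_add)
      ultimately show ?thesis by (simp only: power_one mult_1_right) (simp add: g_def)
    qed
    moreover have "(\<Prod>k\<in>{1..m}. exp (-1) * (\<rho> k)\<^sup>2) \<le> (\<Prod>k\<in>{1..m}. g k (W k))"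
    proof (intro prod_mono conjI)
      fix k assume k: "k \<in> {1..m}"
      have "exp (-1) * (\<rho> k)\<^sup>2 \<le> exp (- (cmod 0 + \<rho> k)\<^sup>2) * (\<rho> k)\<^sup>2"
        using \<rho>[of k] by (intro mult_right_mono) (auto simp: power_le_one)
      moreover have "ennreal (exp (- (cmod 0 + \<rho> k)\<^sup>2) * (\<rho> k)\<^sup>2) \<le> ennreal (g k (W k))"
        using complex_gaussian_cball_ge[OF \<rho>(1), of 0 k] emeasure_gaussian[OF W, of k k] k
        by (simp add: g_def emeasure_eq_measure W_def)
      ultimately show "exp (-1) * (\<rho> k)\<^sup>2 \<le> g k (W k)"
        by (simp add: g_def)
    qed auto
    ultimately show ?thesis by (simp add: mult_mono prod_nonneg g_def)
  qed
  ultimately show ?thesis by simp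
qed

end

section \<open>Log-concave sequences\<close>

text \<open>\<open>concave\<close> is the three-point inequality cleared of denominators; the
  natural subtractions are exact because i < j < k.\<close>

locale log_concave_seq =
  fixes c :: "nat \<Rightarrow> real"
  assumes pos: "c n > 0"
    and concave: "i < j \<Longrightarrow> j < k \<Longrightarrow>
      real (k - j) * ln (c i) + real (j - i) * ln (c k) \<le> real (k - i) * ln (c j)"
    and decay: "filterlim (\<lambda>n. ln (c n) / real n) at_bot sequentially"
begin

text \<open>Meaningful only when \<open>N1 c r\<close> is finite and nonempty, hence the standing
  assumption that 1 belongs to it.\<close>

definition N :: "real \<Rightarrow> nat" where
  "N r = Max (N1 c r)"

lemma ln_term:
  assumes "r > 0"
  shows "ln (c n * r ^ n) = ln (c n) + real n * ln r"
  using assms pos[of n] by (simp add: ln_mult ln_realpow)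

lemma ln_term_concave:
  assumes "r > 0" "i < j" "j < k"
  shows "real (k - j) * ln (c i * r ^ i) + real (j - i) * ln (c k * r ^ k) \<le>
    real (k - i) * ln (c j * r ^ j)"
proof -
  have "real (k - j) * (real i * ln r) + real (j - i) * (real k * ln r) = real (k - i) * (real j * ln r)"
    using assms by (simp add: of_nat_diff algebra_simps)
  with concave[OF assms(2,3)] show ?thesis
    by (simp add: ln_term[OF assms(1)] distrib_left)
qed

lemma eventually_ln_term_le:
  assumes "r > 0"
  shows "eventually (\<lambda>n. ln (c n * r ^ n) \<le> - real n) sequentially"
proof -
  have "eventually (\<lambda>n. ln (c n) / real n \<le> - ln r - 1) sequentially"
    using decay unfolding filterlim_at_bot by blast
  with eventually_gt_at_top[of 0] show ?thesis
    by eventually_elim (auto simp: ln_term[OF assms] field_simps)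
qed

lemma finite_N1:
  assumes "r > 0"
  shows "finite (N1 c r)"
proof -
  obtain m where m: "\<And>n. n \<ge> m \<Longrightarrow> ln (c n * r ^ n) \<le> - real n"
    using eventually_ln_term_le[OF assms] by (auto simp: eventually_sequentially)
  have "N1 c r \<subseteq> {..Suc m}"
  proof
    fix n assume "n \<in> N1 c r"
    then show "n \<in> {..Suc m}"
      using m[of n] by (cases "n \<le> Suc m") (auto simp: N1_def)
  qed
  then show ?thesis by (rule finite_subset) auto
qed

text \<open>\<open>N1 c r\<close> collects exactly the nonnegative terms, so no finite index set has
  a larger sum. This lets index sets from another radius be compared with \<open>S\<close>.\<close>

lemma sum_le_S:
  assumes "r > 0" "finite A"
  shows "2 * (\<Sum>n\<in>A. ln (c n * r ^ n)) \<le> S c r"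
proof -
  have "(\<Sum>n\<in>A. ln (c n * r ^ n)) \<le> (\<Sum>n\<in>A \<inter> N1 c r. ln (c n * r ^ n))"
    using sum_nonpos[of "A - N1 c r" "\<lambda>n. ln (c n * r ^ n)"] assms(2)
    by (subst sum.Int_Diff[of A _ "N1 c r"]) (auto simp: N1_def)
  also have "\<dots> \<le> (\<Sum>n\<in>N1 c r. ln (c n * r ^ n))"
    using finite_N1[OF assms(1)] by (intro sum_mono2) (auto simp: N1_def)
  finally show ?thesis by (simp add: S_def)
qed

lemma S_at_top: "filterlim (S c) at_top at_top"
proof (rule filterlim_at_top_mono)
  show "filterlim (\<lambda>r. 2 * (ln (c 1) + ln r)) at_top at_top"
    by real_asymp
  show "eventually (\<lambda>r. 2 * (ln (c 1) + ln r) \<le> S c r) at_top"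
    using eventually_gt_at_top[of 0]
  proof eventually_elim
    case (elim r)
    then show ?case using sum_le_S[of r "{1}"] ln_term[of r 1] by simp
  qed
qed

text \<open>Index 1 is the anchor rather than 0: its term grows with r, whereas membership of 0
  depends only on the size of \<open>c 0\<close>.\<close>

lemma one_in_N1: "eventually (\<lambda>r. 1 \<in> N1 c r) at_top"
proof -
  have "eventually (\<lambda>r. 0 \<le> ln (c 1) + ln r) at_top" by real_asymp
  with eventually_gt_at_top[of 0] show ?thesis
    by eventually_elim (use ln_term[of _ 1] in \<open>simp add: N1_def\<close>)
qed

context
  fixes r :: real
  assumes r: "r > 0" and one: "1 \<in> N1 c r"
begin

lemma N_in: "N r \<in> N1 c r"
  unfolding N_def using one finite_N1[OF r] by (intro Max_in) auto

lemma le_N: "n \<in> N1 c r \<Longrightarrow> n \<le> N r"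
  unfolding N_def using finite_N1[OF r] by (intro Max_ge) auto

lemma N_ge_1: "N r \<ge> 1"
  using le_N[OF one] .

text \<open>A concave sequence that is nonnegative at 1 and at \<open>N r\<close> is nonnegative in
  between.\<close>

lemma N1_mono: "k \<in> {1..N r} \<Longrightarrow> k \<in> N1 c r"
proof -
  assume k: "k \<in> {1..N r}"
  consider "k = 1" | "k = N r" | "1 < k" "k < N r" using k by fastforce
  then show ?thesis
  proof cases
    case 1
    show ?thesis unfolding 1 by (rule one)
  next
    case 2
    show ?thesis unfolding 2 by (rule N_in)
  next
    case 3
    have "0 \<le> real (N r - k) * ln (c 1 * r ^ 1) + real (k - 1) * ln (c (N r) * r ^ N r)"
      using N_in one by (intro add_nonneg_nonneg mult_nonneg_nonneg) (auto simp: N1_def)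
    also have "\<dots> \<le> real (N r - 1) * ln (c k * r ^ k)"
      using 3 by (rule ln_term_concave[OF r])
    finally show ?thesis
      using 3 by (simp add: N1_def zero_le_mult_iff)
  qed
qed

text \<open>Only index 0 is undetermined; it accounts for the corrections by |ln c_0|.\<close>

lemma N1_cases: "N1 c r = {1..N r} \<or> N1 c r = insert 0 {1..N r}"
proof (cases "0 \<in> N1 c r")
  case True
  have "n \<in> insert 0 {1..N r}" if "n \<in> N1 c r" for n
    using le_N[OF that] by (cases n) auto
  then have "N1 c r = insert 0 {1..N r}" using True N1_mono by blast
  then show ?thesis ..
next
  case False
  have "n \<in> {1..N r}" if "n \<in> N1 c r" for n
    using le_N[OF that] that False by (cases n) auto
  then have "N1 c r = {1..N r}" using N1_mono by blast
  then show ?thesis ..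
qed

lemma sum_upto_N_le: "2 * (\<Sum>k\<in>{1..N r}. ln (c k * r ^ k)) \<le> S c r"
  by (rule sum_le_S[OF r]) auto

lemma sum_upto_N_ge: "2 * (\<Sum>k\<in>{1..N r}. ln (c k * r ^ k)) \<ge> S c r - 2 * \<bar>ln (c 0)\<bar>"
  using N1_cases by (auto simp: S_def)

lemma ln_term_le_S:
  assumes "k \<in> N1 c r"
  shows "ln (c k * r ^ k) \<le> S c r / 2"
  using sum_le_S[OF r, of "{k}"] by simp

lemma S_growth:
  assumes "r \<le> y"
  shows "S c y \<ge> S c r + real (N r + 1) ^ 2 / 2 * ln (y / r)"
proof -
  have y: "y > 0" using r assms by simp
  have l: "ln (y / r) \<ge> 0" using r assms by simp
  have "(N r + 1) * (N r + 1) \<le> (2 * N r) * (N r + 1)"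
    using N_ge_1 by (intro mult_le_mono1) auto
  then have "real ((N r + 1) * (N r + 1)) \<le> real ((2 * N r) * (N r + 1))"
    unfolding of_nat_le_iff .
  then have "real (N r + 1) ^ 2 / 2 \<le> real (N r * Suc (N r))"
    by (simp add: power2_eq_square algebra_simps)
  also have "\<dots> = 2 * (\<Sum>n\<in>{1..N r}. real n)"
  proof -
    have "real (m * Suc m) = 2 * (\<Sum>n\<in>{1..m}. real n)" for m
      by (induction m) (auto simp: algebra_simps)
    then show ?thesis .
  qed
  also have "\<dots> = 2 * (\<Sum>n\<in>N1 c r. real n)"
    using N1_cases by auto
  finally have "real (N r + 1) ^ 2 / 2 * ln (y / r) \<le> 2 * (\<Sum>n\<in>N1 c r. real n) * ln (y / r)"
    using l by (rule mult_right_mono)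
  also have "\<dots> = 2 * (\<Sum>n\<in>N1 c r. ln (c n * y ^ n)) - S c r"
  proof -
    have "(\<Sum>n\<in>N1 c r. real n) * ln (y / r) =
        (\<Sum>n\<in>N1 c r. ln (c n * y ^ n) - ln (c n * r ^ n))"
      unfolding sum_distrib_right using r y
      by (intro sum.cong) (auto simp: ln_term ln_div algebra_simps)
    then show ?thesis by (simp add: S_def sum_subtractf)
  qed
  also have "\<dots> \<le> S c y - S c r"
    using sum_le_S[OF y finite_N1[OF r]] by simp
  finally show ?thesis by simp
qed

text \<open>If \<open>p\<close> indexes the maximal term, then \<open>ln (c p * r ^ p) \<ge> S c r / (2 * (N r + 1))\<close>, and the
  logarithms of the terms drop below \<open>0\<close> within \<open>N r + 1\<close> steps; by concavity this slope persists.\<close>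

lemma ln_term_tail:
  assumes "k > N r"
  shows "ln (c k * r ^ k) \<le> - real (k - N r - 1) * (S c r / (2 * real (N r + 1) ^ 2))"
proof -
  define n where "n = N r + 1"
  define \<beta> where "\<beta> k = ln (c k * r ^ k)" for k
  define B where "B = Max (\<beta> ` N1 c r)"
  have ne: "N1 c r \<noteq> {}" using one by auto
  obtain p where p: "p \<in> N1 c r" "B = \<beta> p"
  proof -
    have "B \<in> \<beta> ` N1 c r"
      unfolding B_def using finite_N1[OF r] ne by (intro Max_in) auto
    then show thesis using that by blast
  qed
  have "(\<Sum>k\<in>N1 c r. \<beta> k) \<le> (\<Sum>k\<in>N1 c r. B)"
    unfolding B_def by (intro sum_mono Max_ge) (auto intro: finite_N1[OF r])
  also have "\<dots> \<le> real n * B"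
  proof -
    have "card (N1 c r) \<le> n"
      using N1_cases unfolding n_def by auto
    moreover have "B \<ge> 0" using p by (simp add: N1_def \<beta>_def)
    ultimately show ?thesis by (simp add: mult_right_mono)
  qed
  finally have SB: "S c r \<le> 2 * real n * B" by (simp add: S_def \<beta>_def)
  have n_pos: "real n > 0" by (simp add: n_def)
  have out: "\<beta> k < 0" if "k > N r" for k
    using le_N[of k] that by (force simp: N1_def \<beta>_def)
  have pn: "p < n" using le_N[OF p(1)] by (simp add: n_def)
  have key: "\<beta> k * real n \<le> - real (k - n) * B"
  proof (cases "k = n")
    case True
    then show ?thesis using out[OF assms] n_pos by (simp add: mult_le_0_iff)
  next
    case False
    then have nk: "n < k" using assms by (simp add: n_def)
    have "real (k - n) * B + real (n - p) * \<beta> k \<le> real (k - p) * \<beta> n"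
      using ln_term_concave[OF r pn nk] by (simp add: p(2) \<beta>_def)
    also have "\<dots> \<le> 0"
      using out[of n] by (simp add: n_def mult_le_0_iff)
    finally have *: "real (n - p) * \<beta> k \<le> - (real (k - n) * B)" by simp
    \<comment> \<open>As \<open>\<beta> k\<close> is negative, enlarging the factor n - p to n
      lowers the product; this removes the unknown position \<open>p\<close> of the maximum.\<close>
    have "real n * \<beta> k \<le> real (n - p) * \<beta> k"
      using out[OF assms] by (intro mult_right_mono_neg) auto
    with * show ?thesis by (simp add: mult.commute)
  qed
  have "S c r / (2 * real n) \<le> B"
    using SB n_pos by (simp add: field_simps)
  then have "real (k - n) * (S c r / (2 * real n)) \<le> real (k - n) * B"
    by (rule mult_left_mono) simp
  with key have "\<beta> k * real n \<le> - real (k - n) * (S c r / (2 * real n))" by simp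
  then have "\<beta> k \<le> (- real (k - n) * (S c r / (2 * real n))) / real n"
    unfolding pos_le_divide_eq[OF n_pos] .
  also have "\<dots> = - real (k - n) * (S c r / (2 * real n ^ 2))"
    by (simp add: power2_eq_square)
  finally show ?thesis
    by (simp add: n_def \<beta>_def)
qed

end

end

section \<open>The exceptional set\<close>

lemma nn_integral_inverse_Icc:
  fixes a b :: real
  assumes "0 < a" "a \<le> b"
  shows "(\<integral>\<^sup>+t\<in>{a..b}. ennreal (1 / t) \<partial>lebesgue) = ennreal (ln b - ln a)"
proof -
  have "(\<integral>\<^sup>+t\<in>{a..b}. ennreal (1 / t) \<partial>lebesgue) = (\<integral>\<^sup>+t\<in>{a..b}. ennreal (1 / t) \<partial>lborel)"
    by (rule nn_integral_completion)
  also have "\<dots> = ennreal (ln b - ln a)"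
    using assms by (intro nn_integral_FTC_Icc) (auto intro!: derivative_eq_intros)
  finally show ?thesis .
qed

lemma finite_log_measure_countable_cover:
  fixes l u :: "nat \<Rightarrow> real"
  assumes "\<And>j. 1 \<le> l j" "\<And>j. l j \<le> u j" "summable (\<lambda>j. ln (u j) - ln (l j))"
  shows "finite_log_measure (\<Union>j. {l j..u j})"
proof -
  have "(\<integral>\<^sup>+t\<in>(\<Union>j. {l j..u j}). ennreal (1 / t) \<partial>lebesgue) \<le>
      (\<integral>\<^sup>+t. (\<Sum>j. ennreal (1 / t) * indicator {l j..u j} t) \<partial>lebesgue)"
  proof (intro nn_integral_mono)
    fix t :: real
    show "ennreal (1 / t) * indicator (\<Union>j. {l j..u j}) t \<le>
        (\<Sum>j. ennreal (1 / t) * indicator {l j..u j} t)"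
    proof (cases "t \<in> (\<Union>j. {l j..u j})")
      case True
      then obtain j where "t \<in> {l j..u j}" by auto
      then have "ennreal (1 / t) * indicator (\<Union>j. {l j..u j}) t =
          (\<Sum>i\<in>{j}. ennreal (1 / t) * indicator {l i..u i} t)"
        using True by simp
      also have "\<dots> \<le> (\<Sum>j. ennreal (1 / t) * indicator {l j..u j} t)"
        by (intro sum_le_suminf) auto
      finally show ?thesis .
    qed simp
  qed
  also have "\<dots> = (\<Sum>j. \<integral>\<^sup>+t\<in>{l j..u j}. ennreal (1 / t) \<partial>lebesgue)"
    by (intro nn_integral_suminf) (auto intro!: measurable_completion)
  also have "\<dots> = (\<Sum>j. ennreal (ln (u j) - ln (l j)))"
    using assms(1,2) by (intro suminf_cong nn_integral_inverse_Icc) (auto intro: less_le_trans[of 0 1])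
  also have "\<dots> < \<infinity>"
  proof -
    have "ln (u j) - ln (l j) \<ge> 0" for j
      using assms(1,2)[of j] by simp
    then show ?thesis
      using assms(3) by (simp add: suminf_ennreal2)
  qed
  moreover have "(\<Union>j. {l j..u j}) \<subseteq> {1..}"
    using assms(1) by (force intro: order_trans)
  ultimately show ?thesis
    by (auto simp: finite_log_measure_def)
qed

context log_concave_seq
begin

text \<open>Borel's growth lemma on the layers \<open>2 ^ j \<le> S < 2 ^ (j + 1)\<close>: by \<open>S_growth\<close>, a bad
  radius in such a layer is followed by a logarithmic length of order at most
  \<open>2 powr (j - 6 * j / 5)\<close> before the layer is left.\<close>

lemma N_le_S_powr:
  "\<exists>E. finite_log_measure E \<and>
     eventually (\<lambda>r. r \<notin> E \<longrightarrow> real (N r + 1) \<le> S c r powr (3/5)) at_top"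
proof -
  define bad where "bad r \<longleftrightarrow> 1 \<le> r \<and> 1 \<in> N1 c r \<and> real (N r + 1) > S c r powr (3/5)" for r
  define F where "F j = {r. bad r \<and> 2 ^ j \<le> S c r \<and> S c r < 2 ^ Suc j}" for j
  \<comment> \<open>The upper edge 2^(j+1) of the layer divided by the least slope 2^(6j/5) / 2 on
    it.\<close>
  define D :: "nat \<Rightarrow> real" where "D j = 4 * (2 powr (-1/5)) ^ j" for j
  \<comment> \<open>An empty layer receives a dummy interval starting at 1; its logarithmic length
    is \<open>D j\<close> like the others, so summability is unaffected.\<close>
  define l where "l j = (if F j = {} then 1 else Inf (F j))" for j
  define u where "u j = l j * exp (D j)" for j
  \<comment> \<open>All bad radii of one layer lie within logarithmic distance \<open>D j\<close>,
    so a single interval covers them although bad and good radii may alternate.\<close>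
  have close: "ln (y / x) \<le> D j" if "x \<in> F j" "y \<in> F j" "x \<le> y" for x y j
  proof -
    have x: "1 \<le> x" "1 \<in> N1 c x" "real (N x + 1) > S c x powr (3/5)" "2 ^ j \<le> S c x"
      using that by (auto simp: F_def bad_def)
    have Sy: "S c y < 2 ^ Suc j" using that by (auto simp: F_def)
    have l0: "ln (y / x) \<ge> 0" using x that by simp
    have "(2::real) powr (6/5 * real j) = (2 ^ j) powr (6/5)"
      by (simp add: powr_realpow[symmetric] powr_powr mult.commute)
    also have "\<dots> \<le> S c x powr (6/5)"
      using x by (intro powr_mono2) auto
    also have "\<dots> = (S c x powr (3/5)) ^ 2"
      by (simp add: power2_eq_square powr_add[symmetric])
    also have "\<dots> \<le> real (N x + 1) ^ 2"
      using x by (intro power_mono) auto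
    finally have *: "2 powr (6/5 * real j) \<le> real (N x + 1) ^ 2" .
    have "S c x + real (N x + 1) ^ 2 / 2 * ln (y / x) \<le> S c y"
      using x that by (intro S_growth) auto
    moreover have "2 powr (6/5 * real j) / 2 * ln (y / x) \<le> real (N x + 1) ^ 2 / 2 * ln (y / x)"
      using * l0 by (intro mult_right_mono) auto
    moreover have "S c x \<ge> 0"
      using x(4) by (rule order_trans[rotated]) simp
    ultimately have "2 powr (6/5 * real j) / 2 * ln (y / x) \<le> 2 ^ Suc j"
      using Sy by linarith
    then have "2 powr (6/5 * real j) * ln (y / x) \<le> 4 * 2 powr real j"
      by (simp add: powr_realpow)
    also have "\<dots> = 2 powr (6/5 * real j) * (4 * 2 powr (- 1/5 * real j))"
      by (simp add: powr_add[symmetric])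
    also have "2 powr (- 1/5 * real j) = ((2::real) powr (-1/5)) ^ j"
      by (simp add: powr_realpow[symmetric] powr_powr)
    finally show ?thesis by (simp add: D_def)
  qed
  have F_ge: "1 \<le> x" if "x \<in> F j" for x j using that by (auto simp: F_def bad_def)
  have bdd: "bdd_below (F j)" for j using F_ge by (intro bdd_belowI[of _ 1])
  have l1: "1 \<le> l j" for j
    unfolding l_def using F_ge by (auto intro!: cInf_greatest)
  have D0: "D j \<ge> 0" for j by (simp add: D_def)
  have lu: "l j \<le> u j" for j
    using l1[of j] D0[of j] mult_left_mono[of 1 "exp (D j)" "l j"] by (simp add: u_def)
  have cover: "F j \<subseteq> {l j..u j}" for j
  proof
    fix y assume y: "y \<in> F j"
    then have ne: "F j \<noteq> {}" and lj: "l j = Inf (F j)" by (auto simp: l_def)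
    have "l j \<le> y" unfolding lj using y bdd by (rule cInf_lower)
    \<comment> \<open>The infimum need not belong to the layer, so the distance bound is proved for
      every member and then passed to the infimum.\<close>
    moreover have "y * exp (- D j) \<le> l j"
      unfolding lj
    proof (rule cInf_greatest[OF ne])
      fix x assume x: "x \<in> F j"
      have px: "x \<ge> 1" "y \<ge> 1" using F_ge x y by auto
      show "y * exp (- D j) \<le> x"
      proof (cases "x \<le> y")
        case True
        have "y / x = exp (ln (y / x))" using px by simp
        also have "\<dots> \<le> exp (D j)" using close[OF x y True] by simp
        finally show ?thesis using px by (simp add: exp_minus field_simps)
      next
        case False
        have "y * exp (- D j) \<le> y * 1"
          using px D0[of j] by (intro mult_left_mono) auto
        with False show ?thesis by simp
      qed
    qed
    then have "y \<le> u j" by (simp add: u_def exp_minus field_simps)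
    ultimately show "y \<in> {l j..u j}" by simp
  qed
  have "summable D"
    unfolding D_def by (intro summable_mult summable_geometric) (simp add: powr_less_one)
  moreover have "(\<lambda>j. ln (u j) - ln (l j)) = D"
  proof
    fix j show "ln (u j) - ln (l j) = D j"
      using l1[of j] by (simp add: u_def ln_mult)
  qed
  ultimately have "finite_log_measure (\<Union>j. {l j..u j})"
    by (intro finite_log_measure_countable_cover l1 lu) simp
  moreover have "eventually (\<lambda>r. r \<notin> (\<Union>j. {l j..u j}) \<longrightarrow> real (N r + 1) \<le> S c r powr (3/5)) at_top"
    using one_in_N1 eventually_ge_at_top[of 1] S_at_top[unfolded filterlim_at_top, rule_format, of 1]
  proof eventually_elim
    case (elim r)
    show ?case
    proof (rule impI, rule ccontr)
      assume r: "r \<notin> (\<Union>j. {l j..u j})" and "\<not> real (N r + 1) \<le> S c r powr (3/5)"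
      then have "bad r" using elim by (simp add: bad_def)
      define j where "j = nat \<lfloor>log 2 (S c r)\<rfloor>"
      have "real j = real_of_int \<lfloor>log 2 (S c r)\<rfloor>"
        using elim by (simp add: j_def)
      then have "real j \<le> log 2 (S c r)" "log 2 (S c r) < real (Suc j)"
        unfolding of_nat_Suc by linarith+
      then have "2 ^ j \<le> S c r" "S c r < 2 ^ Suc j"
        using elim le_log_iff[of 2 "S c r" "real j"] log_less_iff[of 2 "S c r" "real (Suc j)"]
        by (simp_all only: powr_realpow)
      with \<open>bad r\<close> have "r \<in> F j" by (simp add: F_def)
      with cover r show False by blast
    qed
  qed
  ultimately show ?thesis by blast
qed

end

section \<open>Geometric decay of the terms at a good radius\<close>

context log_concave_seq
begin

context
  fixes r s q :: real and n :: nat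
  assumes r: "r > 0" and one: "1 \<in> N1 c r"
  defines "s \<equiv> S c r" and "n \<equiv> N r + 1" and "q \<equiv> exp (- s / (4 * (real n)\<^sup>2))"
  assumes s: "s \<ge> 1" and n: "real n \<le> s powr (3/5)"
begin

text \<open>Half of the rate in \<open>ln_term_tail\<close>, because thresholds of the form (c_k
  r^k)^(-1/2) leave square roots of the terms to be summed.\<close>

lemma sqrt_tail:
  assumes "k \<ge> n"
  shows "sqrt (c k * r ^ k) \<le> q ^ (k - n)"
proof -
  have p: "c k * r ^ k > 0" using pos r by simp
  have "ln (c k * r ^ k) \<le> - real (k - n) * (s / (2 * (real n)\<^sup>2))"
    using ln_term_tail[OF r one, of k] assms by (simp add: n_def s_def)
  also have "\<dots> = 2 * (real (k - n) * (- s / (4 * (real n)\<^sup>2)))"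
    by (simp add: field_simps)
  finally have "exp (ln (c k * r ^ k) / 2) \<le> exp (real (k - n) * (- s / (4 * (real n)\<^sup>2)))"
    by simp
  moreover have "exp (ln (c k * r ^ k) / 2) = sqrt (c k * r ^ k)"
    using p by (intro real_sqrt_unique[symmetric]) (auto simp: power2_eq_square simp flip: exp_add)
  ultimately show ?thesis
    unfolding q_def exp_of_nat_mult[symmetric] by simp
qed

lemma term_less_1:
  assumes "k \<ge> n"
  shows "c k * r ^ k < 1"
proof (rule ccontr)
  assume "\<not> c k * r ^ k < 1"
  then have "k \<in> N1 c r" by (simp add: N1_def)
  from le_N[OF r one this] assms show False by (simp add: n_def)
qed

lemma term_le:
  "c k * r ^ k \<le> exp (s / 2)"
proof (cases "k \<in> N1 c r")
  case True
  have "c k * r ^ k > 0" using pos r by simp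
  then have "c k * r ^ k = exp (ln (c k * r ^ k))" by simp
  also have "\<dots> \<le> exp (s / 2)"
    using ln_term_le_S[OF r one True] by (simp add: s_def)
  finally show ?thesis .
next
  case False
  have "c k * r ^ k > 0" using pos r by simp
  with False have "c k * r ^ k \<le> 1" by (simp add: N1_def)
  also have "1 \<le> exp (s / 2)" using s by simp
  finally show ?thesis .
qed

lemma n_pos: "real n > 0"
  by (simp add: n_def)

lemma q_bounds: "0 < q" "q < 1"
  using s n_pos by (auto simp: q_def)

text \<open>With q = exp(-x), the inequality exp x \<ge> 1 + x gives 1 / (1 - q) \<le> 1 + 1/x, and
  1/x = 4 n^2 / s; the exponent 1/5 is 2 * 3/5 - 1.\<close>

lemma inverse_1_minus_q: "1 / (1 - q) \<le> 1 + 4 * s powr (1/5)"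
proof -
  define x where "x = s / (4 * (real n)\<^sup>2)"
  have x: "x > 0" using s n_pos by (simp add: x_def)
  have "q = 1 / exp x" by (simp add: q_def x_def exp_minus inverse_eq_divide)
  also have "\<dots> \<le> 1 / (1 + x)"
    using x by (intro divide_left_mono) (auto intro: exp_ge_add_one_self)
  finally have "1 - q \<ge> x / (1 + x)" using x by (simp add: field_simps)
  then have "1 / (1 - q) \<le> 1 / (x / (1 + x))"
    using x q_bounds by (intro divide_left_mono) auto
  also have "\<dots> = 1 + 4 * ((real n)\<^sup>2 / s)"
    using x s n_pos by (simp add: x_def field_simps)
  also have "(real n)\<^sup>2 / s \<le> s powr (1/5)"
  proof -
    have "(real n)\<^sup>2 \<le> (s powr (3/5))\<^sup>2" using n by (intro power_mono) auto
    also have "\<dots> = s powr (1/5) * s powr 1"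
      unfolding power2_eq_square powr_add[symmetric] by simp
    also have "s powr 1 = s" using s by simp
    finally show ?thesis using s by (simp add: field_simps)
  qed
  finally show ?thesis by simp
qed

text \<open>Here q^n = exp(-s / (4 n)), and 2/5 = 1 - 3/5. This gain pays for the factor 1 / (1 -
  q), which may itself be large.\<close>

lemma q_power_n: "q ^ n \<le> exp (- (s powr (2/5)) / 4)"
proof -
  have "s powr (2/5) * real n \<le> s powr (2/5) * s powr (3/5)"
    using n by (intro mult_left_mono) auto
  also have "\<dots> = s" using s by (simp flip: powr_add)
  finally have *: "s powr (2/5) \<le> s / real n" using n_pos by (simp add: field_simps)
  have "q ^ n = exp (real n * (- s / (4 * (real n)\<^sup>2)))"
    unfolding q_def exp_of_nat_mult ..
  also have "real n * (- s / (4 * (real n)\<^sup>2)) = - (s / real n) / 4"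
    using n_pos by (simp add: power2_eq_square field_simps)
  finally show ?thesis using * by simp
qed

text \<open>The weights dominate min(1, sqrt(c_k r^k)): there are \<open>n\<close> indices from 0 to
  \<open>N r\<close>, followed by a geometric series.\<close>

lemma weights_sums:
  "(\<lambda>k. if k < n then 1 else q ^ (k - n)) sums (real n + 1 / (1 - q))"
proof -
  have "(\<lambda>k. if k + n < n then 1 else q ^ (k + n - n)) sums (1 / (1 - q))"
    using geometric_sums[of q] q_bounds by simp
  then show ?thesis
    by (subst (asm) sums_iff_shift) (simp add: add.commute)
qed

end

end

section \<open>Asymptotics of the hole probability\<close>

text \<open>Bounds the sum of the weights in \<open>weights_sums\<close>.\<close>

definition tail_weight :: "real \<Rightarrow> real" where
  "tail_weight s = s powr (3/5) + 1 + 4 * s powr (1/5)"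

locale gaussian_log_concave = gaussian_seq M \<phi> + log_concave_seq c
  for M :: "'a measure" and \<phi> :: "nat \<Rightarrow> 'a \<Rightarrow> complex" and c :: "nat \<Rightarrow> real"
begin

text \<open>\<open>hole_prob_upper\<close> with \<delta> = exp(-s) and T = s. After extracting
  exp(-s), the bracket lists the costs of a small \<open>\<phi> 0\<close>, a large
  \<open>\<phi> 0\<close>, a coefficient above its threshold, and the disks.\<close>

lemma hole_prob_le:
  fixes r :: real
  defines "s \<equiv> S c r" and "A \<equiv> \<bar>ln (c 0)\<bar>"
  assumes r: "r > 0" and one: "1 \<in> N1 c r" and s: "S c r \<ge> 1"
    and n: "real (N r + 1) \<le> S c r powr (3/5)"
  shows "hole_prob M \<phi> c r \<le> exp (- s) * (exp (- s) + 2 * exp (s - s\<^sup>2 / 2) + 2 * tail_weight s +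
    exp (2 * s powr (3/5) * ln (1 + c 0 * s * (5 * s + 2 * ln (tail_weight s) + 2 * A)) + 2 * A))"
proof -
  define n where "n = N r + 1"
  define q where "q = exp (- s / (4 * (real n)\<^sup>2))"
  define W where "W = tail_weight s"
  \<comment> \<open>The constant 5 is 2 * (3/2 + 1): 3/2 from the bound exp(3s/2) * W on |f|, and 1
    from \<delta> = exp(-s).\<close>
  define L where "L = 5 * s + 2 * ln W + 2 * A"
  note assms' = r one s n
  have s1: "s \<ge> 1" and n_le: "real n \<le> s powr (3/5)"
    using s n by (simp_all add: s_def n_def)
  note tail = sqrt_tail[OF assms', folded n_def s_def, folded q_def]
  note q = q_bounds[OF assms', folded n_def s_def, folded q_def]
  note weights = weights_sums[OF assms', folded n_def s_def, folded q_def]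
  note inv_q = inverse_1_minus_q[OF assms', folded n_def s_def, folded q_def]
  define w where "w k = (if k < n then 1 else q ^ (k - n))" for k
  have w_sums: "w sums (real n + 1 / (1 - q))"
    unfolding w_def[abs_def] by (rule weights)
  have w_pos: "w k > 0" for k using q by (simp add: w_def)
  have w_sum: "summable w" "suminf w \<le> W"
    using sums_summable[OF w_sums] sums_unique[OF w_sums, symmetric] inv_q n_le
    by (auto simp: W_def tail_weight_def)
  have W1: "W \<ge> 1" using s1 by (simp add: W_def tail_weight_def)
  define b where "b k = c k * r ^ k" for k
  have b: "b k > 0" for k using pos r by (simp add: b_def)
  have wb: "min 1 (sqrt (b k)) \<le> w k" "max (b k) (sqrt (b k)) \<le> exp (s / 2) * w k" for k
  proof -
    have e: "exp (s / 2) \<ge> 1" using s1 by simp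
    have be: "b k \<le> exp (s / 2)"
      unfolding b_def s_def by (rule term_le[OF assms'])
    have "sqrt (b k) \<le> exp (s / 2)"
    proof (cases "b k \<le> 1")
      case True
      then have "sqrt (b k) \<le> 1" by simp
      with e show ?thesis by linarith
    next
      case False
      then have "b k * 1 \<le> b k * b k" using b[of k] by (intro mult_left_mono) auto
      then have "sqrt (b k) \<le> b k"
        using b[of k] by (intro real_le_lsqrt) (auto simp: power2_eq_square)
      with be show ?thesis by linarith
    qed
    with be have lt: "max (b k) (sqrt (b k)) \<le> exp (s / 2) * w k" if "k < n"
      using that by (simp add: w_def)
    have ge: "sqrt (b k) \<le> w k" "b k \<le> sqrt (b k)" if "\<not> k < n"
    proof -
      show "sqrt (b k) \<le> w k" using that tail[of k] by (simp add: b_def w_def)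
      have "b k < 1" unfolding b_def
        using that by (intro term_less_1[OF assms']) (simp add: n_def)
      then have "b k * b k \<le> b k * 1" using b[of k] by (intro mult_left_mono) auto
      then show "b k \<le> sqrt (b k)" by (intro real_le_rsqrt) (simp add: power2_eq_square)
    qed
    show "min 1 (sqrt (b k)) \<le> w k"
    proof (cases "k < n")
      case True
      then show ?thesis by (simp add: w_def)
    next
      case False
      then show ?thesis using ge(1) by simp
    qed
    have "w k \<le> exp (s / 2) * w k" using e w_pos[of k] by simp
    with lt ge show "max (b k) (sqrt (b k)) \<le> exp (s / 2) * w k"
      by (cases "k < n") auto
  qed
  \<comment> \<open>The factor exp s makes the sum of 2 / t k about exp(-s); the maximum keeps that
    sum convergent for small terms without lowering the thresholds of the large ones.\<close>
  define t where "t k = exp s * max 1 (1 / sqrt (b k))" for k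
  have t_pos: "t k > 0" for k by (simp add: t_def)
  have t1: "t k * c k * r ^ k \<le> exp (3 / 2 * s) * w k" for k
  proof -
    have "t k * c k * r ^ k = exp s * (b k * max 1 (1 / sqrt (b k)))"
      by (simp add: t_def b_def)
    also have "b k * max 1 (1 / sqrt (b k)) = max (b k) (b k / sqrt (b k))"
      using b[of k] by (simp add: max_mult_distrib_left)
    also have "b k / sqrt (b k) = sqrt (b k)"
      using b[of k] by (simp add: real_div_sqrt)
    also have "exp s * max (b k) (sqrt (b k)) \<le> exp s * (exp (s / 2) * w k)"
      by (intro mult_left_mono wb) auto
    also have "\<dots> = exp (3 / 2 * s) * w k" by (simp flip: exp_add mult.assoc)
    finally show ?thesis .
  qed
  have t1_nonneg: "t k * c k * r ^ k \<ge> 0" for k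
    using t_pos[of k] pos[of k] r by simp
  have t2: "2 / t k \<le> 2 * exp (- s) * w k" for k
  proof -
    have "2 / t k = 2 * exp (- s) * (1 / max 1 (1 / sqrt (b k)))"
      by (simp add: t_def exp_minus field_simps)
    also have "1 / max 1 (1 / sqrt (b k)) = min 1 (sqrt (b k))"
      using b[of k] by (auto simp: max_def min_def field_simps)
    finally show ?thesis using wb(1)[of k] by simp
  qed
  have summ1: "summable (\<lambda>k. t k * c k * r ^ k)"
    by (rule summable_comparison_test'[OF summable_mult[OF w_sum(1), of "exp (3 / 2 * s)"]])
      (use t1 t1_nonneg in \<open>simp add: abs_of_nonneg\<close>)
  have "(\<Sum>k. t k * c k * r ^ k) \<le> (\<Sum>k. exp (3 / 2 * s) * w k)"
    by (intro suminf_le t1 summ1 summable_mult w_sum)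
  also have "\<dots> = exp (3 / 2 * s) * suminf w" by (rule suminf_mult[OF w_sum(1)])
  also have "\<dots> \<le> exp (3 / 2 * s) * W" using w_sum by simp
  finally have B: "(\<Sum>k. t k * c k * r ^ k) \<le> exp (3 / 2 * s) * W" .
  have summ2: "summable (\<lambda>k. 2 / t k)"
    by (rule summable_comparison_test'[OF summable_mult[OF w_sum(1), of "2 * exp (- s)"]])
      (use t2 t_pos in \<open>simp add: abs_of_pos\<close>)
  have "(\<Sum>k. 2 / t k) \<le> (\<Sum>k. 2 * exp (- s) * w k)"
    by (intro suminf_le t2 summ2 summable_mult w_sum)
  also have "\<dots> = 2 * exp (- s) * suminf w" by (rule suminf_mult[OF w_sum(1)])
  also have "\<dots> \<le> 2 * exp (- s) * W" using w_sum by simp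
  finally have B2: "(\<Sum>k. 2 / t k) \<le> 2 * exp (- s) * W" .
  have lnW: "ln W \<ge> 0" using W1 by simp
  have L0: "L \<ge> 0" using s1 lnW by (simp add: L_def A_def)
  have L: "2 * (ln (exp (3 / 2 * s) * W) - ln (c 0 * exp (- s))) \<le> L"
    using W1 pos[of 0] by (simp add: ln_mult L_def A_def)
  have "hole_prob M \<phi> c r \<le> (exp (- s))\<^sup>2 + 2 * exp (- s\<^sup>2 / 2) + (\<Sum>k. 2 / t k) +
      (\<Prod>k\<in>{1..N r}. (c 0 * s * L / (c k * r ^ k))\<^sup>2)"
    using s1 by (intro hole_prob_upper[OF pos r _ _ t_pos summ1 B summ2 L L0]) auto
  also have "(\<Prod>k\<in>{1..N r}. (c 0 * s * L / (c k * r ^ k))\<^sup>2) \<le>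
      exp (- s) * exp (2 * s powr (3/5) * ln (1 + c 0 * s * L) + 2 * A)"
  proof -
    \<comment> \<open>The added 1 makes ln Q nonnegative, so that the number of disks
      \<open>N r\<close> can be replaced by its upper bound s^(3/5).\<close>
    define Q where "Q = 1 + c 0 * s * L"
    have cL: "c 0 * s * L \<ge> 0" using pos[of 0] s1 L0 by simp
    have Q: "Q \<ge> 1" using cL by (simp add: Q_def)
    have "(\<Prod>k\<in>{1..N r}. (c 0 * s * L / (c k * r ^ k))\<^sup>2) \<le>
        (\<Prod>k\<in>{1..N r}. exp (2 * ln Q - 2 * ln (c k * r ^ k)))"
    proof (intro prod_mono conjI)
      fix k
      have "(c 0 * s * L / b k)\<^sup>2 \<le> (Q / b k)\<^sup>2"
        using cL b[of k] by (intro power_mono divide_right_mono divide_nonneg_pos) (auto simp: Q_def)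
      also have "\<dots> = exp (ln (Q / b k)) * exp (ln (Q / b k))"
        using Q b[of k] by (simp add: power2_eq_square)
      also have "\<dots> = exp (ln (Q / b k) + ln (Q / b k))"
        by (rule exp_add[symmetric])
      also have "ln (Q / b k) + ln (Q / b k) = 2 * ln Q - 2 * ln (b k)"
        using Q b[of k] by (simp add: ln_div)
      finally show "(c 0 * s * L / (c k * r ^ k))\<^sup>2 \<le> exp (2 * ln Q - 2 * ln (c k * r ^ k))"
        by (simp add: b_def)
    qed auto
    also have "\<dots> = exp (2 * real (N r) * ln Q - 2 * (\<Sum>k\<in>{1..N r}. ln (c k * r ^ k)))"
      by (simp add: exp_sum[symmetric] sum_subtractf sum_distrib_left)
    also have "\<dots> \<le> exp (- s + (2 * s powr (3/5) * ln Q + 2 * A))"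
    proof -
      have "real (N r) * ln Q \<le> s powr (3/5) * ln Q"
        using n_le Q by (intro mult_right_mono) (auto simp: n_def)
      then show ?thesis
        using sum_upto_N_ge[OF r one] by (simp add: s_def A_def)
    qed
    finally show ?thesis unfolding Q_def exp_add[of "- s"] .
  qed
  also have "(exp (- s))\<^sup>2 = exp (- s) * exp (- s)" by (simp add: power2_eq_square)
  also have "2 * exp (- s\<^sup>2 / 2) = exp (- s) * (2 * exp (s - s\<^sup>2 / 2))"
    by (simp flip: exp_add)
  finally show ?thesis
    using B2 unfolding L_def W_def by (simp add: algebra_simps)
qed

text \<open>Origin of the loss: ln 2 from the union bound, (3 / c_0 + 2)^2 from the large constant
  coefficient, and, with at most 2n small coefficients, one unit each from the Gaussian density and
  2 ln(2n) each from the factor 1 / (2n) in the radii.\<close>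

lemma hole_prob_ge:
  fixes r :: real
  defines "s \<equiv> S c r"
  assumes r: "r > 0" and one: "1 \<in> N1 c r" and s: "S c r \<ge> 1"
    and n: "real (N r + 1) \<le> S c r powr (3/5)"
    and small: "exp (- (S c r powr (2/5)) / 4) * (1 + 4 * S c r powr (1/5)) \<le> 1 / 4"
  shows "hole_prob M \<phi> c r \<ge> exp (- s - (ln 2 + (3 / c 0 + 2)\<^sup>2 + 2 * s powr (3/5) +
    4 * s powr (3/5) * ln (2 * s powr (3/5))))"
proof -
  define n where "n = N r + 1"
  define q where "q = exp (- s / (4 * (real n)\<^sup>2))"
  note assms' = r one s n
  have s1: "s \<ge> 1" and n_le: "real n \<le> s powr (3/5)"
    using s n by (simp_all add: s_def n_def)
  note tail = sqrt_tail[OF assms', folded n_def s_def, folded q_def]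
  note q = q_bounds[OF assms', folded n_def s_def, folded q_def]
  note inv_q = inverse_1_minus_q[OF assms', folded n_def s_def, folded q_def]
  note q_n = q_power_n[OF assms', folded n_def s_def, folded q_def]
  \<comment> \<open>Thus the unrestricted tail starts at index 2n, which yields the extra factor
    q^n; starting at n would leave a sum of order 1 / (1 - q), not bounded by a constant
    here.\<close>
  define m where "m = 2 * N r + 1"
  have mn: "Suc m = 2 * n" by (simp add: m_def n_def)
  define b where "b k = c k * r ^ k" for k
  have b: "b k > 0" for k using pos r by (simp add: b_def)
  \<comment> \<open>Each of the m < 2n terms is at most 1 / (2n), so together they contribute at
    most 1; the minimum keeps the radii at most 1 where the terms are small.\<close>
  define \<rho> where "\<rho> k = min 1 (1 / b k) / (2 * real n)" for k
  define t where "t k = 1 / sqrt (b k)" for k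
  have n1: "real n \<ge> 1" by (simp add: n_def)
  have \<rho>: "0 \<le> \<rho> k" "\<rho> k \<le> 1" for k
  proof -
    show "0 \<le> \<rho> k" using b[of k] by (simp add: \<rho>_def)
    have "min 1 (1 / b k) \<le> 2 * real n" using n1 by linarith
    then show "\<rho> k \<le> 1" using n1 by (simp add: \<rho>_def)
  qed
  have t_pos: "t k > 0" for k using b[of k] by (simp add: t_def)
  have conv: "conv_radius (\<lambda>k. t k * c k) = \<infinity>"
  proof (rule conv_radius_inftyI'[of 0])
    fix R :: real assume R: "R > 0"
    have "summable (\<lambda>k. (t k * c k) * R ^ k)"
    proof (rule summable_comparison_test_ev)
      show "summable (\<lambda>k. exp (- 1 / 2 :: real) ^ k)" by (intro summable_geometric) simp
      \<comment> \<open>Since t_k c_k = sqrt(c_k / r^k), the square of t_k c_k R^k is the k-th term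
        at radius R^2 / r.\<close>
      have "R\<^sup>2 / r > 0" using R r by simp
      from eventually_ln_term_le[OF this]
      show "eventually (\<lambda>k. norm ((t k * c k) * R ^ k) \<le> exp (- 1 / 2) ^ k) sequentially"
      proof eventually_elim
        case (elim k)
        let ?u = "c k * (R\<^sup>2 / r) ^ k"
        have u: "?u > 0" using pos[of k] R r by simp
        have "((t k * c k) * R ^ k)\<^sup>2 = ?u"
          using b[of k] pos[of k] r
          by (simp add: t_def power_mult_distrib power_divide b_def power2_eq_square field_simps)
        also have "?u \<le> (exp (- 1 / 2) ^ k)\<^sup>2"
        proof -
          have "?u = exp (ln ?u)" using u by simp
          also have "\<dots> \<le> exp (- real k)" using elim by simp
          also have "\<dots> = (exp (- 1 / 2) ^ k)\<^sup>2"
            by (simp flip: exp_of_nat_mult exp_add add: power2_eq_square)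
          finally show ?thesis .
        qed
        finally have "(t k * c k) * R ^ k \<le> exp (- 1 / 2) ^ k"
          by (rule power2_le_imp_le) simp
        moreover have "(t k * c k) * R ^ k \<ge> 0"
          using t_pos[of k] pos[of k] R by simp
        ultimately show ?case by (simp only: real_norm_def abs_of_nonneg)
      qed
    qed
    then show "\<exists>z. norm z = R \<and> summable (\<lambda>k. t k * c k * z ^ k)"
      using R by (intro exI[of _ R]) auto
  qed
  define \<eta> where "\<eta> = q ^ n / (1 - q)"
  have g_sums: "(\<lambda>k. q ^ (k + n)) sums \<eta>"
    using sums_mult2[OF geometric_sums[of q], of "q ^ n"] q by (simp add: \<eta>_def power_add)
  have \<eta>: "\<eta> \<le> 1 / 4"
  proof -
    have "\<eta> = q ^ n * (1 / (1 - q))" by (simp add: \<eta>_def)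
    also have "\<dots> \<le> exp (- (s powr (2/5)) / 4) * (1 + 4 * s powr (1/5))"
      using q by (intro mult_mono q_n inv_q) auto
    finally show ?thesis using small unfolding s_def by linarith
  qed
  have tail': "sqrt (b (k + Suc m)) \<le> q ^ (k + n)" for k
  proof -
    have "k + Suc m - n = k + n" "k + Suc m \<ge> n" by (auto simp: m_def n_def)
    then show ?thesis using tail[of "k + Suc m"] by (simp add: b_def)
  qed
  have sq_summ: "summable (\<lambda>k. sqrt (b (k + Suc m)))"
    by (rule summable_comparison_test'[OF sums_summable[OF g_sums]])
      (use tail' b in \<open>simp add: abs_of_pos less_imp_le\<close>)
  have "(\<Sum>k. sqrt (b (k + Suc m))) \<le> (\<Sum>k. q ^ (k + n))"
    by (intro suminf_le tail' sq_summ sums_summable[OF g_sums])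
  also have "\<dots> = \<eta>" by (rule sums_unique[OF g_sums, symmetric])
  finally have sq_sum: "(\<Sum>k. sqrt (b (k + Suc m))) \<le> 1 / 4" using \<eta> by linarith
  have t_inv: "(\<lambda>k. 2 / t (k + Suc m)) = (\<lambda>k. 2 * sqrt (b (k + Suc m)))"
    by (simp add: t_def)
  have summ: "summable (\<lambda>k. 2 / t (k + Suc m))"
    unfolding t_inv by (intro summable_mult sq_summ)
  have half: "(\<Sum>k. 2 / t (k + Suc m)) \<le> 1 / 2"
    unfolding t_inv suminf_mult[OF sq_summ] using sq_sum by simp
  have big: "(\<Sum>k\<in>{1..m}. \<rho> k * (c k * r ^ k)) +
      (\<Sum>k. t (k + Suc m) * c (k + Suc m) * r ^ (k + Suc m)) < c 0 * (3 / c 0)"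
  proof -
    have "(\<Sum>k\<in>{1..m}. \<rho> k * (c k * r ^ k)) \<le> (\<Sum>k\<in>{1..m}. 1 / (2 * real n))"
    proof (rule sum_mono)
      fix k
      have "\<rho> k * b k = (min 1 (1 / b k) * b k) / (2 * real n)" by (simp add: \<rho>_def)
      also have "\<dots> \<le> 1 / (2 * real n)"
        using b[of k] by (intro divide_right_mono) (auto simp: min_def field_simps)
      finally show "\<rho> k * (c k * r ^ k) \<le> 1 / (2 * real n)" by (simp add: b_def)
    qed
    also have "\<dots> = real m / (2 * real n)" by simp
    also have "\<dots> \<le> 1"
    proof -
      have "m \<le> 2 * n" using mn by simp
      then have "real m \<le> 2 * real n" by linarith
      then show ?thesis using n1 by (simp add: field_simps)
    qed
    finally have 1: "(\<Sum>k\<in>{1..m}. \<rho> k * (c k * r ^ k)) \<le> 1" .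
    have "t k * c k * r ^ k = sqrt (b k)" for k
    proof -
      have "t k * c k * r ^ k = b k / sqrt (b k)" by (simp add: t_def b_def)
      also have "\<dots> = sqrt (b k)" using b[of k] by (simp add: real_div_sqrt)
      finally show ?thesis .
    qed
    then have "(\<Sum>k. t (k + Suc m) * c (k + Suc m) * r ^ (k + Suc m)) \<le> 1 / 4"
      using sq_sum by (simp only:)
    with 1 show ?thesis using pos[of 0] by simp
  qed
  \<comment> \<open>This choice makes the constant term at least 3, against at most 1 + 1/4 from all
    other terms.\<close>
  have K: "3 / c 0 > 0" using pos[of 0] by simp
  have P: "hole_prob M \<phi> c r \<ge> 1 / 2 * exp (- (3 / c 0 + 2)\<^sup>2) * (\<Prod>k\<in>{1..m}. exp (-1) * (\<rho> k)\<^sup>2)"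
    by (rule hole_prob_lower[OF pos r \<rho> t_pos K conv big summ half])
  \<comment> \<open>Chosen so that min(1, 1 / b_k) = exp(-l_k) for 1 \<le> k \<le> m: the indices
    beyond \<open>N r\<close> cost only the factor 1 / (2n), not their logarithms.\<close>
  define l where "l k = (if k \<in> {1..N r} then ln (b k) else 0)" for k
  have "(\<Prod>k\<in>{1..m}. exp (-1) * (\<rho> k)\<^sup>2) = (\<Prod>k\<in>{1..m}. exp (-1 - 2 * ln (2 * real n) - 2 * l k))"
  proof (rule prod.cong[OF refl])
    fix k assume k: "k \<in> {1..m}"
    have "\<rho> k = exp (- l k) / (2 * real n)"
    proof (cases "k \<le> N r")
      case True
      then have "k \<in> N1 c r" using k by (intro N1_mono[OF r one]) auto
      then have "b k \<ge> 1" using b[of k] by (simp add: N1_def b_def)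
      then show ?thesis
        using True k b[of k] by (simp add: \<rho>_def l_def exp_minus inverse_eq_divide)
    next
      case False
      then have "b k < 1" unfolding b_def by (intro term_less_1[OF assms']) simp
      then show ?thesis using False b[of k] by (simp add: \<rho>_def l_def min_def)
    qed
    also have "\<dots> = exp (- l k - ln (2 * real n))"
      using n1 by (simp add: exp_diff)
    finally have "(\<rho> k)\<^sup>2 = exp (- l k - ln (2 * real n)) * exp (- l k - ln (2 * real n))"
      by (simp add: power2_eq_square)
    then show "exp (-1) * (\<rho> k)\<^sup>2 = exp (-1 - 2 * ln (2 * real n) - 2 * l k)"
      by (simp flip: exp_add)
  qed
  also have "\<dots> = exp (real m * (-1 - 2 * ln (2 * real n)) - 2 * (\<Sum>k\<in>{1..m}. l k))"
  proof -
    have "(\<Prod>k\<in>{1..m}. exp (C - 2 * l k)) = exp (real m * C - 2 * (\<Sum>k\<in>{1..m}. l k))" for C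
      by (simp add: exp_sum[symmetric] sum_subtractf sum_distrib_left)
    then show ?thesis .
  qed
  also have "(\<Sum>k\<in>{1..m}. l k) = (\<Sum>k\<in>{1..N r}. ln (b k))"
    unfolding l_def by (rule sum.mono_neutral_cong_right) (auto simp: m_def)
  finally have prod_eq: "(\<Prod>k\<in>{1..m}. exp (-1) * (\<rho> k)\<^sup>2) =
      exp (real m * (-1 - 2 * ln (2 * real n)) - 2 * (\<Sum>k\<in>{1..N r}. ln (b k)))" .
  have sumb: "2 * (\<Sum>k\<in>{1..N r}. ln (b k)) \<le> s"
    using sum_upto_N_le[OF r one] by (simp add: b_def s_def)
  define X where "X = s powr (3/5)"
  have "real m * (1 + 2 * ln (2 * real n)) \<le> (2 * X) * (1 + 2 * ln (2 * X))"
  proof (intro mult_mono)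
    have "m \<le> 2 * n" using mn by simp
    then show "real m \<le> 2 * X" using n_le unfolding X_def by linarith
    show "1 + 2 * ln (2 * real n) \<le> 1 + 2 * ln (2 * X)"
      using ln_mono[of "2 * real n" "2 * X"] n_le n1 by (simp add: X_def)
    show "0 \<le> 2 * X" by (simp add: X_def)
    have "ln (2 * real n) \<ge> 0" using n1 by (intro ln_ge_zero) linarith
    then show "0 \<le> 1 + 2 * ln (2 * real n)" by linarith
  qed
  then have "- s - (ln 2 + (3 / c 0 + 2)\<^sup>2 + 2 * X + 4 * X * ln (2 * X)) \<le>
      - ln 2 + (- (3 / c 0 + 2)\<^sup>2) + (real m * (-1 - 2 * ln (2 * real n)) - 2 * (\<Sum>k\<in>{1..N r}. ln (b k)))"
    using sumb by (simp add: algebra_simps)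
  then have "exp (- s - (ln 2 + (3 / c 0 + 2)\<^sup>2 + 2 * X + 4 * X * ln (2 * X))) \<le>
      exp (- ln 2 + (- (3 / c 0 + 2)\<^sup>2) + (real m * (-1 - 2 * ln (2 * real n)) - 2 * (\<Sum>k\<in>{1..N r}. ln (b k))))"
    by (simp only: exp_le_cancel_iff)
  also have "\<dots> = 1 / 2 * exp (- (3 / c 0 + 2)\<^sup>2) * (\<Prod>k\<in>{1..m}. exp (-1) * (\<rho> k)\<^sup>2)"
    unfolding prod_eq exp_add by (simp add: exp_minus)
  finally show ?thesis using P unfolding X_def by linarith
qed

end

text \<open>All secondary costs have logarithm O(s^(3/5) ln s), and s^(7/10) absorbs the logarithm
  and the constants.\<close>

lemma asymptotic_aux:
  fixes c0 A :: real
  assumes "c0 > 0" "A \<ge> 0"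
  shows "eventually (\<lambda>s. exp (- s) + 2 * exp (s - s\<^sup>2 / 2) + 2 * tail_weight s +
    exp (2 * s powr (3/5) * ln (1 + c0 * s * (5 * s + 2 * ln (tail_weight s) + 2 * A)) + 2 * A)
      \<le> exp (s powr (7/10))) at_top"
  and "eventually (\<lambda>s. ln 2 + (3 / c0 + 2)\<^sup>2 + 2 * s powr (3/5) +
    4 * s powr (3/5) * ln (2 * s powr (3/5)) \<le> s powr (7/10)) at_top"
  and "eventually (\<lambda>s. exp (- (s powr (2/5)) / 4) * (1 + 4 * s powr (1/5)) \<le> (1 / 4 :: real)) at_top"
  subgoal unfolding tail_weight_def using assms by real_asymp
  subgoal using assms by real_asymp
  subgoal by real_asymp
  done

theorem theorem1:
  fixes a :: "real \<Rightarrow> real"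
    and M :: "'a measure"
    and \<phi> :: "nat \<Rightarrow> 'a \<Rightarrow> complex"
  assumes a_pos: "\<And>t. t \<ge> 0 \<Longrightarrow> a t > 0"
    and a_log_concave: "concave_on {0..} (\<lambda>t. ln (a t))"
    and a_C2: "C2_on {0<..} a"
    and a_decay: "filterlim (\<lambda>t. ln (a t) / t) at_bot at_top"
    and prob: "prob_space M"
    and indep: "prob_space.indep_vars M (\<lambda>_. borel) \<phi> UNIV"
    and gauss: "\<And>n. std_complex_gaussian M (\<phi> n)"
  shows "\<exists>E. finite_log_measure E \<and>
    (\<lambda>r. hole_exponent M \<phi> (\<lambda>n. a (real n)) r - S (\<lambda>n. a (real n)) r)
      \<in> o[inf at_top (principal (- E))](S (\<lambda>n. a (real n)))"
proof -
  define c where "c n = a (real n)" for n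
  interpret prob_space M by (rule prob)
  interpret gaussian_log_concave M \<phi> c
  proof unfold_locales
    show "indep_vars (\<lambda>_. borel) \<phi> UNIV" "\<And>n. std_complex_gaussian M (\<phi> n)"
      by (rule indep, rule gauss)
    show "c n > 0" for n by (simp add: c_def a_pos)
    show "filterlim (\<lambda>n. ln (c n) / real n) at_bot sequentially"
      unfolding c_def by (rule filterlim_compose[OF a_decay filterlim_real_sequentially])
    show "real (k - j) * ln (c i) + real (j - i) * ln (c k) \<le> real (k - i) * ln (c j)"
      if "i < j" "j < k" for i j k
    proof -
      \<comment> \<open>Barycentric weights that express j through i and k.\<close>
      define u where "u = (real k - real j) / (real k - real i)"
      define v where "v = (real j - real i) / (real k - real i)"
      have d: "real k - real i > 0" using that by simp
      have uv: "u \<ge> 0" "v \<ge> 0" "u + v = 1"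
        using that by (auto simp: u_def v_def simp flip: add_divide_distrib)
      have "u * real i + v * real k = real j"
        using d by (simp add: u_def v_def divide_simps) (simp add: algebra_simps)
      moreover have "u * ln (a (real i)) + v * ln (a (real k)) \<le> ln (a (u *\<^sub>R real i + v *\<^sub>R real k))"
        using a_log_concave uv unfolding concave_on_iff by auto
      ultimately have "u * ln (c i) + v * ln (c k) \<le> ln (c j)" by (simp add: c_def)
      then have "(real k - real i) * (u * ln (c i) + v * ln (c k)) \<le> (real k - real i) * ln (c j)"
        using d by (intro mult_left_mono) auto
      also have "(real k - real i) * (u * ln (c i) + v * ln (c k)) =
          ((real k - real i) * u) * ln (c i) + ((real k - real i) * v) * ln (c k)"
        by (simp add: algebra_simps)
      finally show ?thesis
        using d that by (simp add: u_def v_def of_nat_diff)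
    qed
  qed
  obtain E where E: "finite_log_measure E"
    "eventually (\<lambda>r. r \<notin> E \<longrightarrow> real (N r + 1) \<le> S c r powr (3/5)) at_top"
    using N_le_S_powr by blast
  have "\<bar>ln (c 0)\<bar> \<ge> 0" by simp
  note asym = asymptotic_aux[OF pos[of 0] this, THEN eventually_compose_filterlim[OF _ S_at_top]]
  have "eventually (\<lambda>r. r \<notin> E \<longrightarrow> \<bar>hole_exponent M \<phi> c r - S c r\<bar> \<le> S c r powr (7/10)) at_top"
    using E(2) one_in_N1 eventually_gt_at_top[of 0]
      S_at_top[unfolded filterlim_at_top, rule_format, of 1] asym
  proof eventually_elim
    case (elim r)
    show ?case
    proof
      assume "r \<notin> E"
      then have n: "real (N r + 1) \<le> S c r powr (3/5)" using elim(1) by blast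
      let ?p = "hole_prob M \<phi> c r"
      have "exp (- S c r - S c r powr (7/10)) \<le> ?p"
        by (rule order_trans[OF _ hole_prob_ge[OF elim(3,2,4) n elim(7)]]) (use elim(6) in simp)
      moreover have "?p \<le> exp (- S c r + S c r powr (7/10))"
        unfolding exp_add
        by (rule order_trans[OF hole_prob_le[OF elim(3,2,4) n] mult_left_mono[OF elim(5)]]) simp
      \<comment> \<open>Positivity must precede taking logarithms, because ln 0 = 0 would make the
        exponent meaningless.\<close>
      moreover from calculation(1) have "?p > 0" by (rule less_le_trans[OF exp_gt_zero])
      ultimately have "- S c r - S c r powr (7/10) \<le> ln ?p" "ln ?p \<le> - S c r + S c r powr (7/10)"
        by (simp_all add: ln_ge_iff) (metis exp_le_cancel_iff exp_ln)
      then show "\<bar>hole_exponent M \<phi> c r - S c r\<bar> \<le> S c r powr (7/10)"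
        by (simp add: hole_exponent_def abs_le_iff)
    qed
  qed
  then have "(\<lambda>r. hole_exponent M \<phi> c r - S c r) \<in> O[inf at_top (principal (- E))](\<lambda>r. S c r powr (7/10))"
    by (intro landau_o.big_mono) (simp add: eventually_inf_principal)
  \<comment> \<open>As S tends to infinity, also along radii off E, the comparison reduces to
    s^(7/10) = o(s) in one real variable.\<close>
  moreover have "(\<lambda>r. S c r powr (7/10)) \<in> o[inf at_top (principal (- E))](S c)"
  proof (rule landau_o.small.compose)
    show "(\<lambda>s::real. s powr (7/10)) \<in> o[at_top](\<lambda>s. s)" by real_asymp
    show "filterlim (S c) at_top (inf at_top (principal (- E)))"
      using S_at_top by (rule filterlim_mono) auto
  qed
  ultimately have "(\<lambda>r. hole_exponent M \<phi> c r - S c r) \<in> o[inf at_top (principal (- E))](S c)"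
    by (rule landau_o.big_small_trans)
  with E(1) show ?thesis unfolding c_def[abs_def] by blast
qed

end
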